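(* Let $H\subset G$ be connected reductive algebraic groups over a finite field $\mathbb{F}$, let $\mathbb{E}/\mathbb{F}$ be the quadratic extension, and $\langle\sigma\rangle=\mathrm{Gal}(\mathbb{E}/\mathbb{F})$. Let $\pi_1$ be an irreducible uniform representation of $G(\mathbb{F})$ and $\pi_2$ an irreducible uniform representation of $H(\mathbb{F})$. Assume that $\pi_1$ and $\pi_2$ have basechanges $\pi_1^{\mathbb{E}}$ and $\pi_2^{\mathbb{E}}$ to $\mathbb{E}$, which are irreducible $\sigma$-invariant representations of $G(\mathbb{E})$ and $H(\mathbb{E})$ respectively, and let $\tilde\pi_1^{\mathbb{E}}$ and $\tilde\pi_2^{\mathbb{E}}$ be their extensions to $G(\mathbb{E})\rtimes\langle\sigma\rangle$ and $H(\mathbb{E})\rtimes\langle\sigma\rangle$ determined by the Shintani character identity. Then $$2\, m(\tilde\pi_1^{\mathbb{E}},\tilde\pi_2^{\mathbb{E}}) = m(\pi_1^{\mathbb{E}},\pi_2^{\mathbb{E}}) + m(\pi_1,\pi_2),$$ where $$m(\tilde\pi_1^{\mathbb{E}},\tilde\pi_2^{\mathbb{E}})=\dim \mathrm{Hom}_{H(\mathbb{E})\rtimes\langle\sigma\rangle}(\tilde\pi_1^{\mathbb{E}},\tilde\pi_2^{\mathbb{E}}),\quad m(\pi_1^{\mathbb{E}},\pi_2^{\mathbb{E}})=\dim\mathrm{Hom}_{H(\mathbb{E})}(\pi_1^{\mathbb{E}},\pi_2^{\mathbb{E}}),\quad m(\pi_1,\pi_2)=\dim\mathrm{Hom}_{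H(\mathbb{F})}(\pi_1,\pi_2).$$
   Context: All representations are finite-dimensional and complex. The inclusion $H\subset G$ is defined over $\mathbb{F}$, so $\sigma$ acts compatibly on $H(\mathbb{E})\subset G(\mathbb{E})$. An irreducible representation of $G(\mathbb{F})$ is called uniform if its character is a (rational) linear combination of Deligne-Lusztig characters $R(T,\theta)$, for varying maximal tori $T\subset G$ defined over $\mathbb{F}$ and characters $\theta:T(\mathbb{F})\to\mathbb{C}^\times$. Norm map: let $F$ be the Frobenius of $G$ over $\mathbb{F}$ (acting on $G(\mathbb{E})$ as $\sigma$). For $g\in G(\mathbb{E})$, use Lang's theorem to write $g=a^{-1}F(a)$ with $a\in G(\overline{\mathbb{F}})$; then $\mathrm{Nm}(g)$ is the conjugacy class in $G(\mathbb{F})$ of $a\,g\,\sigma(g)\,a^{-1}=F^2(a)a^{-1}$. This is well defined and induces a bijection from $\sigma$-conjugacy classes in $G(\mathbb{E})$ to conjugacy classes in $G(\mathbb{F})$. Basechange: a $\sigma$-invariant irreducible representation $\pi^{\mathbb{E}}$ of $G(\mathbb{E})$ is the basechange of an irreducible representation $\pi$ of $G(\mathbb{F})$ if it has an extension $\tilde\pi^{\mathbb{E}}$ to $G(\mathbb{E})\rtimes\langle\sigma\rangle$ satisfying the Shintani character identity $\Theta_{\tilde\pi^{\mathbb{E}}}(g\cdot\sigma)=\Theta_{\pi}(\mathrm{Nm}(g))$ for all $g\in G(\mathbb{E})$, where $\Theta$ denotes characters. This identity determines the extension $\tilde\pi^{\mathbb{E}}$ uniquely. The same definitions apply to $H$.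 *)

theory Defs
  imports
    "HOL-Analysis.Analysis"
    "HOL-Algebra.Algebraic_Closure_Type"
    "HOL-Algebra.Solvable_Groups"
    "HOL-Algebra.Elementary_Groups"
    "HOL-Computational_Algebra.Polynomial_FPS"
begin

no_notation fps_nth (infixl "$" 75)

section \<open>Linear algebraic groups as closed subgroups of the general linear group\<close>

definition GL :: "('k::field^'n^'n) monoid" where
  "GL = \<lparr>carrier = {A. invertible A}, monoid.mult = (**), one = mat 1\<rparr>"

text \<open>Polynomial functions of the matrix entries, with coefficients in a subring \<open>K\<close>.\<close>

inductive_set polyfuns :: "'k set \<Rightarrow> ('k::comm_ring_1^'n^'m \<Rightarrow> 'k) set" for K where
  const: "c \<in> K \<Longrightarrow> (\<lambda>_. c) \<in> polyfuns K"
| entry: "(\<lambda>A. A $ i $ j) \<in> polyfuns K"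
| add: "p \<in> polyfuns K \<Longrightarrow> q \<in> polyfuns K \<Longrightarrow> (\<lambda>A. p A + q A) \<in> polyfuns K"
| mult: "p \<in> polyfuns K \<Longrightarrow> q \<in> polyfuns K \<Longrightarrow> (\<lambda>A. p A * q A) \<in> polyfuns K"

definition zariski :: "('k::field^'n^'m) topology" where
  "zariski = topology_generated_by ((\<lambda>p. {A. p A \<noteq> 0}) ` polyfuns UNIV)"

lemma openin_zariski:
  fixes U :: "('k::field^'n^'m) set"
  shows "openin zariski U \<longleftrightarrow> (\<exists>P \<subseteq> polyfuns UNIV. U = {A. \<exists>p\<in>P. p A \<noteq> 0})"
proof
  let ?N = "\<lambda>p :: 'k^'n^'m \<Rightarrow> 'k. {A. p A \<noteq> 0}"
  have inter: "?N (\<lambda>A. p A * q A) = ?N p \<inter> ?N q" for p q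
    by auto
  define D where "D = ?N"
  have D_mult: "D p \<inter> D q \<in> D ` polyfuns UNIV" if "p \<in> polyfuns UNIV" "q \<in> polyfuns UNIV" for p q
    unfolding D_def inter[symmetric] by (rule imageI) (rule polyfuns.mult[OF that])
  assume "openin zariski U"
  then have "generate_topology_on (D ` polyfuns UNIV) U"
    by (simp only: zariski_def openin_topology_generated_by_iff D_def)
  then have "\<forall>A\<in>U. \<exists>V\<in>D ` polyfuns UNIV. A \<in> V \<and> V \<subseteq> U"
  proof induction
    case Empty
    show ?case by blast
  next
    case (Int a b)
    show ?case
    proof
      fix A assume A: "A \<in> a \<inter> b"
      obtain V where V: "V \<in> D ` polyfuns UNIV" "A \<in> V" "V \<subseteq> a"
        using bspec[OF Int.IH(1) IntD1[OF A]] by (elim bexE conjE)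
      obtain W where W: "W \<in> D ` polyfuns UNIV" "A \<in> W" "W \<subseteq> b"
        using bspec[OF Int.IH(2) IntD2[OF A]] by (elim bexE conjE)
      have "V \<inter> W \<in> D ` polyfuns UNIV"
        using V(1) W(1) by (elim imageE) (simp only: D_mult)
      then show "\<exists>V\<in>D ` polyfuns UNIV. A \<in> V \<and> V \<subseteq> a \<inter> b"
        by (rule bexI[rotated]) (intro conjI IntI V(2) W(2) Int_mono V(3) W(3))
    qed
  next
    case (UN K)
    show ?case
    proof
      fix A assume "A \<in> \<Union>K"
      then obtain k where k: "k \<in> K" "A \<in> k" by (elim UnionE)
      obtain V where V: "V \<in> D ` polyfuns UNIV" "A \<in> V" "V \<subseteq> k"
        using bspec[OF UN.IH[OF k(1)] k(2)] by (elim bexE conjE)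
      have "V \<subseteq> \<Union>K"
        using V(3) Union_upper[OF k(1)] by (rule subset_trans)
      then show "\<exists>V\<in>D ` polyfuns UNIV. A \<in> V \<and> V \<subseteq> \<Union>K"
        using V(1,2) by (intro bexI[of _ V] conjI)
    qed
  next
    case (Basis s)
    then show ?case by (intro ballI bexI[of _ s] conjI subset_refl)
  qed
  then have "U = \<Union>(D ` {p \<in> polyfuns UNIV. D p \<subseteq> U})"
    by (simp add: set_eq_iff subset_iff bex_simps) blast
  then show "\<exists>P \<subseteq> polyfuns UNIV. U = {A. \<exists>p\<in>P. p A \<noteq> 0}"
    by (intro exI[of _ "{p \<in> polyfuns UNIV. D p \<subseteq> U}"] conjI) (auto simp only: D_def)
next
  assume "\<exists>P \<subseteq> polyfuns UNIV. U = {A. \<exists>p\<in>P. p A \<noteq> 0}"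
  then obtain P where P: "P \<subseteq> polyfuns UNIV" "U = {A. \<exists>p\<in>P. p A \<noteq> 0}"
    by (elim exE conjE)
  have "openin zariski {A. p A \<noteq> 0}" if "p \<in> P" for p
    unfolding zariski_def openin_topology_generated_by_iff
    by (rule generate_topology_on.Basis, rule imageI, rule subsetD[OF P(1) that])
  then have "openin zariski (\<Union>p\<in>P. {A. p A \<noteq> 0})"
    by (intro openin_Union) (elim imageE, simp only:)
  moreover have "U = (\<Union>p\<in>P. {A. p A \<noteq> 0})"
    unfolding P(2) by (simp add: set_eq_iff)
  ultimately show "openin zariski U"
    by simp
qed

text \<open>
  \<open>closed_subgroup K G\<close>: \<open>G\<close> is a subgroup of \<open>GL\<close> cut out, inside \<open>GL\<close>, by polynomials with
  coefficients in \<open>K\<close>. With \<open>K = UNIV\<close> this is Zariski closedness in \<open>GL\<close>; when the ambient field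
  is an algebraic closure of the perfect field \<open>K\<close>, it says that \<open>G\<close> is defined over \<open>K\<close>.
\<close>

definition closed_subgroup :: "'k set \<Rightarrow> ('k::field^'n^'n) set \<Rightarrow> bool" where
  "closed_subgroup K G \<longleftrightarrow> subgroup G GL \<and>
     (\<exists>P \<subseteq> polyfuns K. G = {A. invertible A \<and> (\<forall>p\<in>P. p A = 0)})"

definition unipotent :: "'k::field^'n^'n \<Rightarrow> bool" where
  "unipotent u \<longleftrightarrow> (\<exists>k. (((**) (u - mat 1)) ^^ k) (mat 1) = 0)"

text \<open>The union is the largest member of the family.\<close>

definition unipotent_radical :: "('k::field^'n^'n) set \<Rightarrow> ('k^'n^'n) set" where
  "unipotent_radical G = \<Union>{U. U \<subseteq> G \<and> closed_subgroup UNIV U \<and> connectedin zariski U \<and>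
     U \<lhd> (GL\<lparr>carrier := G\<rparr>) \<and> (\<forall>u\<in>U. unipotent u)}"

definition borel_subgroup :: "('k::field^'n^'n) set \<Rightarrow> ('k^'n^'n) set \<Rightarrow> bool" where
  "borel_subgroup G B \<longleftrightarrow>
     (let csol = (\<lambda>C. C \<subseteq> G \<and> closed_subgroup UNIV C \<and> connectedin zariski C \<and>
                      solvable (GL\<lparr>carrier := C\<rparr>))
      in csol B \<and> (\<forall>C. csol C \<and> B \<subseteq> C \<longrightarrow> C = B))"

text \<open>A morphism on a closed subgroup of \<open>GL\<close>: its entries are polynomials in the entries of the
  argument and the inverse of its determinant.\<close>

definition regular_map_on :: "('k::field^'n^'n) set \<Rightarrow> ('k^'n^'n \<Rightarrow> 'k^'n^'n) \<Rightarrow> bool" where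
  "regular_map_on Z f \<longleftrightarrow>
     (\<forall>i j. \<exists>p \<in> polyfuns UNIV. \<exists>k. \<forall>A\<in>Z. f A $ i $ j = p A / det A ^ k)"

text \<open>The product of copies of the multiplicative group, one for each index in \<open>I\<close>.\<close>

definition diag_torus :: "'n set \<Rightarrow> ('k::field^'n^'n) set" where
  "diag_torus I = {A. (\<forall>i j. i \<noteq> j \<longrightarrow> A $ i $ j = 0) \<and> (\<forall>i\<in>I. A $ i $ i \<noteq> 0) \<and>
     (\<forall>i. i \<notin> I \<longrightarrow> A $ i $ i = 1)}"

text \<open>A torus is an algebraic group isomorphic to a power of the multiplicative group. A torus inside
  \<open>GL\<close> of size \<open>n\<close> has rank at most \<open>n\<close>, so the powers given by sets of indices \<open>I\<close> suffice.\<close>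

definition is_torus :: "('k::field^'n^'n) set \<Rightarrow> bool" where
  "is_torus T \<longleftrightarrow> closed_subgroup UNIV T \<and>
     (\<exists>I f g. f \<in> iso (GL\<lparr>carrier := T\<rparr>) (GL\<lparr>carrier := diag_torus I\<rparr>) \<and>
        regular_map_on T f \<and> regular_map_on (diag_torus I) g \<and> (\<forall>A\<in>T. g (f A) = A))"

definition maximal_torus :: "('k::field^'n^'n) set \<Rightarrow> ('k^'n^'n) set \<Rightarrow> bool" where
  "maximal_torus G T \<longleftrightarrow> T \<subseteq> G \<and> is_torus T \<and> (\<forall>S. S \<subseteq> G \<and> is_torus S \<and> T \<subseteq> S \<longrightarrow> S = T)"

section \<open>Groups over a finite field\<close>

text \<open>
  The finite field is the type \<open>'a\<close>, with \<open>q = CARD('a)\<close> elements; it is identified with its image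
  under \<open>to_ac\<close> in its algebraic closure \<open>'a alg_closure\<close>. The extension of degree \<open>m\<close> is the
  set of fixed points of the \<open>m\<close>-th power of the \<open>q\<close>-Frobenius.
\<close>

definition connected_reductive :: "('a::{field,finite} alg_closure^'n^'n) set \<Rightarrow> bool" where
  "connected_reductive G \<longleftrightarrow> closed_subgroup (range to_ac) G \<and> connectedin zariski G \<and>
     unipotent_radical G = {mat 1}"

definition frob :: "'a::{field,finite} alg_closure^'n^'m \<Rightarrow> 'a alg_closure^'n^'m" where
  "frob A = (\<chi> i j. (A $ i $ j) ^ CARD('a))"

definition rational_points ::
    "nat \<Rightarrow> ('a::{field,finite} alg_closure^'n^'n) set \<Rightarrow> ('a alg_closure^'n^'n) monoid" where
  "rational_points m G = GL\<lparr>carrier := {g \<in> G. (frob ^^ m) g = g}\<rparr>"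

abbreviation F_points ("_'(\<bbbF>')" [1000] 1000) where "G(\<bbbF>) \<equiv> rational_points 1 G"
abbreviation E_points ("_'(\<bbbE>')" [1000] 1000) where "G(\<bbbE>) \<equiv> rational_points 2 G"

text \<open>The semidirect product of \<open>G(\<bbbE>)\<close> with the group of order two generated by \<open>\<sigma>\<close>;
  the pair \<open>(g, i)\<close> stands for \<open>g \<cdot> \<sigma>\<^sup>i\<close>, and \<open>\<sigma>\<close> acts on \<open>G(\<bbbE>)\<close> as the Frobenius.\<close>

definition E_points_sigma ::
    "('a::{field,finite} alg_closure^'n^'n) set \<Rightarrow> (('a alg_closure^'n^'n) \<times> int) monoid" where
  "E_points_sigma G =
     \<lparr>carrier = carrier (G(\<bbbE>)) \<times> carrier (integer_mod_group 2),
      monoid.mult = (\<lambda>(g, i) (h, j). (g ** (frob ^^ nat i) h, i \<otimes>\<^bsub>integer_mod_group 2\<^esub> j)),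
      one = (mat 1, 0)\<rparr>"

text \<open>
  The norm of \<open>g\<close>, as a set of elements of \<open>G(\<bbbF>)\<close>. All elements \<open>a\<close> with
  \<open>g = a\<inverse> F(a)\<close> contribute; they yield the same conjugacy class.
\<close>

definition Nm :: "('a::{field,finite} alg_closure^'n^'n) set \<Rightarrow> 'a alg_closure^'n^'n \<Rightarrow>
    ('a alg_closure^'n^'n) set" where
  "Nm G g = {x ** (a ** g ** frob g ** matrix_inv a) ** matrix_inv x |x a.
     x \<in> carrier (G(\<bbbF>)) \<and> a \<in> G \<and> g = matrix_inv a ** frob a}"

section \<open>Complex representations\<close>

definition representation :: "('g, 'm) monoid_scheme \<Rightarrow> ('g \<Rightarrow> complex^'d^'d) \<Rightarrow> bool" where
  "representation G \<rho> \<longleftrightarrow> \<rho> \<in> hom G GL"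

text \<open>The space \<open>complex^'d\<close> is never zero.\<close>

definition irreducible_rep :: "('g, 'm) monoid_scheme \<Rightarrow> ('g \<Rightarrow> complex^'d^'d) \<Rightarrow> bool" where
  "irreducible_rep G \<rho> \<longleftrightarrow> representation G \<rho> \<and>
     (\<forall>V. vec.subspace V \<and> (\<forall>g\<in>carrier G. \<forall>v\<in>V. \<rho> g *v v \<in> V) \<longrightarrow> V = {0} \<or> V = UNIV)"

definition rep_iso :: "('g, 'm) monoid_scheme \<Rightarrow> ('g \<Rightarrow> complex^'d^'d) \<Rightarrow>
    ('g \<Rightarrow> complex^'d^'d) \<Rightarrow> bool" where
  "rep_iso G \<rho> \<rho>' \<longleftrightarrow> (\<exists>P. invertible P \<and> (\<forall>g\<in>carrier G. P ** \<rho> g = \<rho>' g ** P))"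

definition Hom_rep :: "('g, 'm) monoid_scheme \<Rightarrow> ('g \<Rightarrow> complex^'d^'d) \<Rightarrow>
    ('g \<Rightarrow> complex^'e^'e) \<Rightarrow> (complex^'d^'e) set" where
  "Hom_rep G \<rho> \<rho>' = {A. \<forall>g\<in>carrier G. A ** \<rho> g = \<rho>' g ** A}"

definition hom_dim :: "('g, 'm) monoid_scheme \<Rightarrow> ('g \<Rightarrow> complex^'d^'d) \<Rightarrow>
    ('g \<Rightarrow> complex^'e^'e) \<Rightarrow> nat" where
  "hom_dim G \<rho> \<rho>' =
     vector_space.dim (\<lambda>c A. \<chi> i j. c * A $ i $ j) (Hom_rep G \<rho> \<rho>')"

section \<open>Deligne--Lusztig characters\<close>

text \<open>
  Let \<open>F\<close> be a Frobenius map of a variety \<open>Z\<close> and let \<open>f\<close> be an automorphism of finite order of \<open>Z\<close>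
  commuting with \<open>F\<close>. The Lefschetz number of \<open>f\<close> is the alternating sum of its traces on the l-adic
  cohomology of \<open>Z\<close> with compact support. By Grothendieck's trace formula it can be computed
  by counting points: the power series \<open>\<Sum>n\<ge>1. card {x \<in> Z. f (F\<^sup>n x) = x} t\<^sup>n\<close> is a rational
  function \<open>P / Q\<close>, and the Lefschetz number is minus its value at \<open>t = \<infinity>\<close>
  (Deligne--Lusztig, Section 3; Carter, Finite groups of Lie type, 7.1). The latter is taken as
  the definition.
\<close>

definition is_lefschetz_number :: "'x set \<Rightarrow> ('x \<Rightarrow> 'x) \<Rightarrow> ('x \<Rightarrow> 'x) \<Rightarrow> complex \<Rightarrow> bool" where
  "is_lefschetz_number Z F f L \<longleftrightarrow> (\<exists>P Q :: complex poly. Q \<noteq> 0 \<and> Polynomial.degree P \<le> Polynomial.degree Q \<and>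
     fps_of_poly Q *
       Abs_fps (\<lambda>n. if n = 0 then 0 else of_nat (card {x \<in> Z. f ((F ^^ n) x) = x})) =
       fps_of_poly P \<and>
     L = - (Polynomial.coeff P (Polynomial.degree Q) / Polynomial.lead_coeff Q))"

lemma is_lefschetz_number_unique:
  assumes "is_lefschetz_number Z F f L" "is_lefschetz_number Z F f L'"
  shows "L = L'"
proof -
  define S :: "complex fps" where
    "S = Abs_fps (\<lambda>n. if n = 0 then 0 else of_nat (card {x \<in> Z. f ((F ^^ n) x) = x}))"
  obtain P Q :: "complex poly" where 1: "Q \<noteq> 0" "Polynomial.degree P \<le> Polynomial.degree Q"
    "fps_of_poly Q * S = fps_of_poly P" "L = - (Polynomial.coeff P (Polynomial.degree Q) / Polynomial.lead_coeff Q)"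
    using assms(1) unfolding is_lefschetz_number_def S_def by blast
  obtain P' Q' :: "complex poly" where 2: "Q' \<noteq> 0" "Polynomial.degree P' \<le> Polynomial.degree Q'"
    "fps_of_poly Q' * S = fps_of_poly P'" "L' = - (Polynomial.coeff P' (Polynomial.degree Q') / Polynomial.lead_coeff Q')"
    using assms(2) unfolding is_lefschetz_number_def S_def by blast
  have "fps_of_poly (P * Q') = fps_of_poly (P' * Q)"
    unfolding fps_of_poly_mult 1(3)[symmetric] 2(3)[symmetric] by (simp add: mult_ac)
  then have eq: "P * Q' = P' * Q"
    by simp
  have coeff: "Polynomial.coeff (A * B) (m + Polynomial.degree B) = Polynomial.coeff A m * Polynomial.lead_coeff B"
    if "Polynomial.degree A \<le> m" for A B :: "complex poly" and m
  proof (cases "Polynomial.degree A = m")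
    case True
    then show ?thesis by (metis coeff_mult_degree_sum)
  next
    case False
    then have "Polynomial.degree (A * B) < m + Polynomial.degree B"
      using that degree_mult_le[of A B] by linarith
    then show ?thesis
      using False that by (simp add: coeff_eq_0)
  qed
  have "Polynomial.coeff P (Polynomial.degree Q) * Polynomial.lead_coeff Q' = Polynomial.coeff P' (Polynomial.degree Q') * Polynomial.lead_coeff Q"
    using coeff[OF 1(2), of Q'] coeff[OF 2(2), of Q] eq by (simp add: add.commute)
  then show ?thesis
    unfolding 1(4) 2(4) using 1(1) 2(1) by (simp add: frac_eq_eq)
qed

definition lefschetz_number :: "'x set \<Rightarrow> ('x \<Rightarrow> 'x) \<Rightarrow> ('x \<Rightarrow> 'x) \<Rightarrow> complex" where
  "lefschetz_number Z F f = (THE L. is_lefschetz_number Z F f L)"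

text \<open>
  \<open>DL_character G T B \<theta>\<close> is the Deligne--Lusztig character \<open>R(T,\<theta>)\<close> of \<open>G(\<bbbF>)\<close>, computed with the
  Borel subgroup \<open>B\<close> containing \<open>T\<close>, on which it does not depend. Writing \<open>U\<close> for the
  unipotent radical of \<open>B\<close>, the group \<open>G(\<bbbF>) \<times> T(\<bbbF>)\<close> acts on the variety of all \<open>x\<close> in \<open>G\<close> with \<open>x\<inverse> F(x) \<in> U\<close> by
  \<open>x \<mapsto> g x t\<close>, and \<open>R(T,\<theta>)\<close> is the character of \<open>G(\<bbbF>)\<close> on the \<open>\<theta>\<close>-isotypic part of its
  cohomology. As \<open>U\<close> need not be stable under \<open>F\<close>, the Frobenius map of this variety is
  the least power \<open>F\<^sup>m\<close> that stabilizes \<open>U\<close>.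
\<close>

definition DL_character :: "('a::{field,finite} alg_closure^'n^'n) set \<Rightarrow> ('a alg_closure^'n^'n) set \<Rightarrow>
    ('a alg_closure^'n^'n) set \<Rightarrow> ('a alg_closure^'n^'n \<Rightarrow> complex) \<Rightarrow>
    'a alg_closure^'n^'n \<Rightarrow> complex" where
  "DL_character G T B \<theta> g =
     (let U = unipotent_radical B;
          Z = {x \<in> G. matrix_inv x ** frob x \<in> U};
          m = (LEAST m. 0 < m \<and> (frob ^^ m) ` U = U)
      in (\<Sum>t \<in> carrier (T(\<bbbF>)).
            \<theta> (matrix_inv t) * lefschetz_number Z (frob ^^ m) (\<lambda>x. g ** x ** t)) /
         of_nat (card (carrier (T(\<bbbF>)))))"

definition DL_data :: "('a::{field,finite} alg_closure^'n^'n) set \<Rightarrow>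
    (('a alg_closure^'n^'n) set \<times> ('a alg_closure^'n^'n) set \<times>
     ('a alg_closure^'n^'n \<Rightarrow> complex)) set" where
  "DL_data G = {(T, B, \<theta>).
     maximal_torus G T \<and> closed_subgroup (range to_ac) T \<and> borel_subgroup G B \<and> T \<subseteq> B \<and>
     \<theta> \<in> hom (T(\<bbbF>)) \<lparr>carrier = - {0}, monoid.mult = (*), one = 1\<rparr>}"

definition uniform_rep :: "('a::{field,finite} alg_closure^'n^'n) set \<Rightarrow>
    ('a alg_closure^'n^'n \<Rightarrow> complex^'d^'d) \<Rightarrow> bool" where
  "uniform_rep G \<pi> \<longleftrightarrow> irreducible_rep (G(\<bbbF>)) \<pi> \<and>
     (\<exists>D c. finite D \<and> D \<subseteq> DL_data G \<and>
        (\<forall>g \<in> carrier (G(\<bbbF>)).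
           trace (\<pi> g) = (\<Sum>(T, B, \<theta>) \<in> D. of_rat (c (T, B, \<theta>)) * DL_character G T B \<theta> g)))"

section \<open>Basechange\<close>

definition sigma_invariant :: "('a::{field,finite} alg_closure^'n^'n) set \<Rightarrow>
    ('a alg_closure^'n^'n \<Rightarrow> complex^'d^'d) \<Rightarrow> bool" where
  "sigma_invariant G \<pi> \<longleftrightarrow> rep_iso (G(\<bbbE>)) (\<pi> \<circ> frob) \<pi>"

text \<open>\<open>\<pi>'\<close> is an extension of \<open>\<pi>E\<close> satisfying the Shintani character identity relative to \<open>\<pi>\<close>.\<close>

definition shintani_extension :: "('a::{field,finite} alg_closure^'n^'n) set \<Rightarrow>
    ('a alg_closure^'n^'n \<Rightarrow> complex^'d^'d) \<Rightarrow> ('a alg_closure^'n^'n \<Rightarrow> complex^'e^'e) \<Rightarrow>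
    (('a alg_closure^'n^'n) \<times> int \<Rightarrow> complex^'e^'e) \<Rightarrow> bool" where
  "shintani_extension G \<pi> \<pi>E \<pi>' \<longleftrightarrow> representation (E_points_sigma G) \<pi>' \<and>
     (\<forall>g \<in> carrier (G(\<bbbE>)). \<pi>' (g, 0) = \<pi>E g) \<and>
     (\<forall>g \<in> carrier (G(\<bbbE>)). \<forall>y \<in> Nm G g. trace (\<pi>' (g, 1)) = trace (\<pi> y))"

definition is_basechange :: "('a::{field,finite} alg_closure^'n^'n) set \<Rightarrow>
    ('a alg_closure^'n^'n \<Rightarrow> complex^'d^'d) \<Rightarrow> ('a alg_closure^'n^'n \<Rightarrow> complex^'e^'e) \<Rightarrow> bool"
  where
  "is_basechange G \<pi> \<pi>E \<longleftrightarrow> irreducible_rep (G(\<bbbF>)) \<pi> \<and> irreducible_rep (G(\<bbbE>)) \<pi>E \<and>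
     sigma_invariant G \<pi>E \<and> (\<exists>\<pi>'. shintani_extension G \<pi> \<pi>E \<pi>')"

end

theory Submission
  imports Defs "HOL-Library.Function_Algebras"
begin

text \<open>
  Write \<open>\<chi>\<^sub>i\<close> for the character of \<open>\<pi>\<^sub>i\<close> and \<open>\<chi>'\<^sub>i\<close> for that of the extension of its basechange. The
  dimension of the space of intertwiners between two representations of a finite group is the
  average of the product of one character with the complex conjugate of the other
  (\<open>hom_dim_eq_character_product\<close>). For the group \<open>H(\<bbbE>) \<rtimes> \<langle>\<sigma>\<rangle>\<close>, of order twice that of \<open>H(\<bbbE>)\<close>,
  the elements \<open>(h, 0)\<close> contribute half of the average over \<open>H(\<bbbE>)\<close>, and the elements \<open>(h, 1)\<close>
  contribute half of the average of \<open>h \<mapsto> \<chi>'\<^sub>2(h, 1) \<cdot> cnj (\<chi>'\<^sub>1(h, 1))\<close>. If \<open>h = a\<inverse> F(a)\<close> with \<open>a\<close> in \<open>H\<close>,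
  then \<open>F\<^sup>2(a) a\<inverse>\<close> lies in the norm of \<open>h\<close> for \<open>H\<close> and also in its norm for \<open>G\<close>, so by the two
  Shintani identities the last function is \<open>\<chi>\<^sub>2 \<cdot> cnj \<chi>\<^sub>1\<close> evaluated at the norm. The norm preserves averages
  (\<open>norm_sum_eq\<close>): on the finite set of all \<open>a\<close> in \<open>H\<close> with \<open>a\<inverse> F(a)\<close> in \<open>H(\<bbbE>)\<close>, or equivalently with
  \<open>F\<^sup>2(a) a\<inverse>\<close> in \<open>H(\<bbbF>)\<close>, the map \<open>a \<mapsto> a\<inverse> F(a)\<close> onto \<open>H(\<bbbE>)\<close> has fibres of size \<open>|H(\<bbbF>)|\<close>, and the map
  \<open>a \<mapsto> F\<^sup>2(a) a\<inverse>\<close> onto \<open>H(\<bbbF>)\<close> has fibres of size \<open>|H(\<bbbE>)|\<close>. So the second half is half of the dimension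
  for \<open>H(\<bbbF>)\<close>.

  Both maps are onto by Lang's theorem (\<open>lang\<close>), for the Frobenius maps \<open>F\<close> and \<open>F\<^sup>2\<close>. Let \<open>F\<close>
  now be the map that raises all entries to the power \<open>Q\<close>, where \<open>Q\<close> is a power of the number of elements of \<open>\<bbbF>\<close>.
  For the general linear group the theorem is semilinear algebra (\<open>lang_GL\<close>). For a closed subgroup \<open>G\<close>
  defined over the finite field one shows that the orbits of the twisted action
  \<open>x \<mapsto> a\<inverse> x F(a)\<close> of \<open>G\<close> on itself are closed and finite in number; as they are disjoint, connectedness
  leaves only one.

  They are closed because each is the image of a closed set under the map \<open>L(a) = a\<inverse> F(a)\<close> of the general
  linear group (\<open>closed_in_GL_lang_image\<close>). That map is finite: where \<open>F(s) = s b\<close>, every polynomial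
  in \<open>s\<close> reduces to a combination of the monomials with all exponents below \<open>Q\<close>, with coefficients
  polynomial in \<open>b\<close>. For invertible \<open>b\<close> the equation \<open>F(s) = s b\<close> has as many solutions as there are such
  monomials, so the coefficients are determined by the values on the solutions, and the vanishing of
  a polynomial on a whole fibre becomes a polynomial condition on \<open>b\<close>.

  They are finite in number by counting (\<open>finite_twisted_orbits\<close>): on the finite group of points of
  \<open>G\<close> over a large enough finite field, the fibres of \<open>a \<mapsto> a\<inverse> x F(a)\<close> are never larger than the
  group \<open>\<Gamma>\<close> of invertible matrices fixed by \<open>F\<close>, so at most \<open>|\<Gamma>|\<close> disjoint orbits fit into that group.
\<close>

section \<open>The Frobenius map on an algebraic closure\<close>

lemma finite_field_power_CARD:
  fixes x :: "'a::{field,finite}"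
  shows "x ^ CARD('a) = x"
proof (cases "x = 0")
  case True
  then show ?thesis by (simp add: zero_power)
next
  case False
  let ?P = "\<Prod>y\<in>UNIV - {0::'a}. y"
  have bij: "bij_betw ((*) x) (UNIV - {0}) (UNIV - {0})"
    by (rule bij_betwI[where g="\<lambda>y. y / x"]) (use False in auto)
  have "?P = (\<Prod>y\<in>UNIV - {0}. x * y)"
    using prod.reindex_bij_betw[OF bij, of "\<lambda>y. y"] by simp
  also have "\<dots> = x ^ (CARD('a) - 1) * ?P"
    by (simp add: prod.distrib card_Diff_singleton)
  finally have "x ^ (CARD('a) - 1) = 1"
    by simp
  then show ?thesis
    using power_minus_mult[of "CARD('a)" x] by simp
qed

text \<open>
  The two sides of \<open>(x + 1)\<^sup>q = x\<^sup>q + 1\<close> agree at all \<open>q\<close> elements of the field, and their difference has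
  degree less than \<open>q\<close>. So all its coefficients vanish. This makes the \<open>q\<close>-power map
  additive.
\<close>
lemma binomial_CARD_field:
  assumes "0 < i" "i < CARD('a::{field,finite})"
  shows "of_nat (CARD('a) choose i) = (0::'a)"
proof -
  let ?q = "CARD('a)"
  define P :: "'a poly" where "P = (\<Sum>j\<in>{1..<?q}. Polynomial.monom (of_nat (?q choose j)) j)"
  have pw: "x ^ ?q = x" for x :: 'a
    by (rule finite_field_power_CARD)
  have q1: "1 < ?q" using assms by simp
  have "poly P x = 0" for x
  proof -
    have "x + 1 = (x + 1) ^ ?q" by (simp add: pw)
    also have "\<dots> = (\<Sum>j\<le>?q. of_nat (?q choose j) * x ^ j)"
      by (subst binomial_ring) (simp add: mult.commute)
    also have "{..?q} = insert 0 (insert ?q {1..<?q})"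
      using q1 by auto
    also have "(\<Sum>j\<in>insert 0 (insert ?q {1..<?q}). of_nat (?q choose j) * x ^ j) = 1 + (x + poly P x)"
      using q1 by (simp add: P_def poly_sum poly_monom pw)
    finally show ?thesis by simp
  qed
  moreover have "Polynomial.degree P < ?q"
  proof -
    have "Polynomial.degree P \<le> ?q - 1"
      unfolding P_def by (rule degree_sum_le) (auto intro!: order.trans[OF degree_monom_le])
    then show ?thesis using q1 by simp
  qed
  ultimately have "P = 0"
    using q1 by (intro poly_eqI_degree[of UNIV P 0]) simp_all
  then have "Polynomial.coeff P i = 0" by simp
  moreover have "Polynomial.coeff P i = of_nat (?q choose i)"
    unfolding P_def using assms by (simp add: Polynomial.coeff_sum sum.delta)
  ultimately show ?thesis by simp
qed

lemma frobenius_add: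
  fixes x y :: "'a::{field,finite} alg_closure"
  shows "(x + y) ^ CARD('a) ^ e = x ^ CARD('a) ^ e + y ^ CARD('a) ^ e"
proof (induction e)
  case 0
  show ?case by simp
next
  case (Suc e)
  let ?q = "CARD('a)"
  have q1: "1 < ?q"
    using card_mono[of UNIV "{0, 1 :: 'a}"] by simp
  have additive: "(u + v) ^ ?q = u ^ ?q + v ^ ?q" for u v :: "'a alg_closure"
  proof -
    have zero: "of_nat (?q choose i) = (0 :: 'a alg_closure)" if "i \<in> {1..<?q}" for i
      using binomial_CARD_field[where 'a='a, of i] that to_ac_of_nat[of "?q choose i", where 'a='a]
      by (metis One_nat_def Suc_le_lessD atLeastLessThan_iff to_ac_0)
    have "(u + v) ^ ?q = (\<Sum>j\<le>?q. of_nat (?q choose j) * u ^ j * v ^ (?q - j))"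
      by (rule binomial_ring)
    also have "{..?q} = insert 0 (insert ?q {1..<?q})"
      using q1 by auto
    also have "(\<Sum>j\<in>insert 0 (insert ?q {1..<?q}). of_nat (?q choose j) * u ^ j * v ^ (?q - j)) =
        v ^ ?q + (u ^ ?q + (\<Sum>j\<in>{1..<?q}. of_nat (?q choose j) * u ^ j * v ^ (?q - j)))"
      using q1 by simp
    also have "(\<Sum>j\<in>{1..<?q}. of_nat (?q choose j) * u ^ j * v ^ (?q - j)) = 0"
      by (intro sum.neutral ballI) (simp only: zero mult_zero_left)
    finally show ?thesis by simp
  qed
  then show ?case
    by (simp add: Suc.IH mult.commute[of ?q] power_mult)
qed

lemma frobenius_sum:
  fixes f :: "'b \<Rightarrow> 'a::{field,finite} alg_closure"
  shows "(\<Sum>i\<in>I. f i) ^ CARD('a) ^ e = (\<Sum>i\<in>I. f i ^ CARD('a) ^ e)"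
  by (induction I rule: infinite_finite_induct) (simp_all add: frobenius_add zero_power)

lemma frobenius_diff:
  fixes x y :: "'a::{field,finite} alg_closure"
  shows "(x - y) ^ CARD('a) ^ e = x ^ CARD('a) ^ e - y ^ CARD('a) ^ e"
  using frobenius_add[of "x - y" y e] by (simp add: algebra_simps)

lemma frobenius_inj:
  fixes x y :: "'a::{field,finite} alg_closure"
  assumes "x ^ CARD('a) ^ e = y ^ CARD('a) ^ e"
  shows "x = y"
  using frobenius_diff[of x y e] assms by simp

lemma frobenius_to_ac: "to_ac (x :: 'a::{field,finite}) ^ CARD('a) ^ e = to_ac x"
  by (induction e) (simp_all add: mult.commute[of "CARD('a)"] power_mult finite_field_power_CARD
      flip: to_ac_power)

text \<open>
  The polynomial \<open>X\<^sup>Q - X\<close> has no multiple roots because its derivative is \<open>-1\<close>.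
\<close>

lemma card_frobenius_fixed:
  assumes "0 < e"
  shows "finite {x :: 'a::{field,finite} alg_closure. x ^ CARD('a) ^ e = x}"
    and "card {x :: 'a alg_closure. x ^ CARD('a) ^ e = x} = CARD('a) ^ e"
proof -
  let ?Q = "CARD('a) ^ e"
  define P :: "'a alg_closure poly" where "P = Polynomial.monom 1 ?Q - Polynomial.monom 1 1"
  have "1 < CARD('a)"
    using card_mono[of UNIV "{0, 1 :: 'a}"] by simp
  then have Q1: "1 < ?Q"
    using assms by (metis one_less_power)
  have "of_nat CARD('a) = (0 :: 'a)"
    using binomial_CARD_field[where 'a='a, of 1] \<open>1 < CARD('a)\<close> by simp
  then have "of_nat CARD('a) = (0 :: 'a alg_closure)"
    by (metis to_ac_0 to_ac_of_nat)
  then have "of_nat ?Q = (0 :: 'a alg_closure)"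
    using assms by (simp add: zero_power)
  then have deriv: "pderiv P = - 1"
    unfolding P_def by (simp add: pderiv_diff pderiv_monom monom_eq_1 del: of_nat_power)
  have deg: "Polynomial.degree P = ?Q"
    unfolding P_def diff_conv_add_uminus using Q1 by (subst degree_add_eq_left) (auto simp: degree_monom_eq)
  have P0: "P \<noteq> 0"
    using deg Q1 by auto
  have roots: "{x. poly P x = 0} = {x. x ^ ?Q = x}"
    by (simp add: P_def poly_monom)
  show fin: "finite {x :: 'a alg_closure. x ^ ?Q = x}"
    using poly_roots_finite[OF P0] by (simp only: roots)
  obtain A where A: "size A = Polynomial.degree P"
    "P = Polynomial.smult (Polynomial.lead_coeff P) (\<Prod>x\<in>#A. [:-x, 1:])"
    using alg_closed_imp_factorization[OF P0] by blast
  have simple: "count A a \<le> 1" for a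
  proof (rule ccontr)
    assume "\<not> count A a \<le> 1"
    then have "Suc (Suc 0) \<le> count A a" by simp
    then have "{#a, a#} \<subseteq># A"
      by (simp add: subseteq_mset_def)
    then obtain B where "A = {#a, a#} + B"
      by (metis subset_mset.add_diff_inverse)
    then have "P = [:-a, 1:] * ([:-a, 1:] * Polynomial.smult (Polynomial.lead_coeff P) (\<Prod>x\<in>#B. [:-x, 1:]))"
      using A(2) by (simp add: mult_ac)
    then obtain R where R: "P = [:-a, 1:] * ([:-a, 1:] * R)"
      by blast
    have "poly (pderiv P) a = 0"
      unfolding R pderiv_mult poly_add poly_mult by simp
    then show False
      by (simp add: deriv)
  qed
  have "set_mset A = {x. poly P x = 0}"
    using P0 by (subst A(2)) (auto simp: poly_prod_mset prod_mset_zero_iff)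
  moreover have "size A = card (set_mset A)"
  proof -
    have "size A = (\<Sum>x\<in>set_mset A. count A x)" by (rule size_multiset_overloaded_eq)
    also have "\<dots> = (\<Sum>x\<in>set_mset A. 1)"
      using simple by (intro sum.cong refl) (metis One_nat_def antisym count_greater_eq_one_iff)
    finally show ?thesis by simp
  qed
  ultimately show "card {x :: 'a alg_closure. x ^ ?Q = x} = ?Q"
    using A(1) by (simp only: deg roots)
qed

text \<open>
  The iterates of \<open>x\<close> under the injective \<open>q\<close>-power map are roots of any polynomial over the finite field
  that has \<open>x\<close> as a root, so there are only finitely many of them.
\<close>
lemma frobenius_periodic:
  fixes x :: "'a::{field,finite} alg_closure"
  shows "\<exists>m>0. x ^ CARD('a) ^ m = x"
proof -
  obtain p :: "'a poly" where p: "p \<noteq> 0" "poly (map_poly to_ac p) x = 0"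
    by (rule alg_closure_algebraic)
  define P where "P = map_poly to_ac p"
  have P0: "P \<noteq> 0"
    using p(1) by (simp add: P_def map_poly_eq_0_iff)
  have "poly P (x ^ CARD('a) ^ i) = 0" for i
  proof -
    have "poly P (x ^ CARD('a) ^ i) = poly P x ^ CARD('a) ^ i"
      by (simp add: poly_altdef P_def coeff_map_poly frobenius_sum power_mult_distrib
          frobenius_to_ac mult.commute flip: power_mult)
    then show ?thesis using p(2) by (simp add: P_def zero_power)
  qed
  then have "range (\<lambda>i. x ^ CARD('a) ^ i) \<subseteq> {x. poly P x = 0}"
    by auto
  then have "finite (range (\<lambda>i. x ^ CARD('a) ^ i))"
    using poly_roots_finite[OF P0] finite_subset by blast
  then have "\<not> inj (\<lambda>i. x ^ CARD('a) ^ i)"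
    using finite_imageD by fastforce
  then obtain i j where ij: "i < j" "x ^ CARD('a) ^ i = x ^ CARD('a) ^ j"
    unfolding inj_def by (metis linorder_neqE_nat)
  have "(x ^ CARD('a) ^ (j - i)) ^ CARD('a) ^ i = x ^ CARD('a) ^ i"
    using ij by (simp flip: power_mult power_add)
  then have "x ^ CARD('a) ^ (j - i) = x"
    by (rule frobenius_inj)
  then show ?thesis using ij(1) by (intro exI[of _ "j - i"]) simp
qed

lemma frobenius_fixed_mult:
  fixes x :: "'a::{field,finite} alg_closure"
  assumes "x ^ CARD('a) ^ m = x"
  shows "x ^ CARD('a) ^ (m * r) = x"
proof (induction r)
  case (Suc r)
  then show ?case
    using assms by (simp add: power_add power_mult)
qed simp

lemma frobenius_common_period:
  fixes S :: "'a::{field,finite} alg_closure set"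
  assumes "finite S"
  shows "\<exists>m>0. \<forall>x\<in>S. x ^ CARD('a) ^ m = x"
  using assms
proof induction
  case empty
  then show ?case by auto
next
  case (insert x S)
  obtain m m' where m: "0 < m" "\<forall>x\<in>S. x ^ CARD('a) ^ m = x"
    and m': "0 < m'" "x ^ CARD('a) ^ m' = x"
    using insert.IH frobenius_periodic by blast
  show ?case
    using m m' frobenius_fixed_mult[of _ m m'] frobenius_fixed_mult[of x m' m]
    by (intro exI[of _ "m * m'"]) (auto simp: mult.commute)
qed

text \<open>
  Over the field with \<open>Q ^ M\<close> elements, where \<open>Q = q ^ e\<close>, the powers \<open>x \<mapsto> x ^ (Q ^ i)\<close> with \<open>i < M\<close> are linearly
  independent functions: a combination is a polynomial of degree at most \<open>Q ^ (M - 1)\<close>, too small to vanish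
  at \<open>Q ^ M\<close> points.
\<close>
lemma frobenius_powers_independent:
  fixes c :: "nat \<Rightarrow> 'a::{field,finite} alg_closure"
  assumes e: "0 < e" and M: "0 < M"
    and zero: "\<And>x. x ^ CARD('a) ^ (e * M) = x \<Longrightarrow> (\<Sum>i<M. c i * x ^ CARD('a) ^ (e * i)) = 0"
    and i: "i < M"
  shows "c i = 0"
proof -
  let ?q = "CARD('a)"
  define P where "P = (\<Sum>i<M. Polynomial.monom (c i) (?q ^ (e * i)))"
  have q1: "1 < ?q"
    using card_mono[of UNIV "{0, 1 :: 'a}"] by simp
  have "Polynomial.degree P \<le> ?q ^ (e * (M - 1))"
    unfolding P_def using q1
    by (intro degree_sum_le) (auto intro!: order.trans[OF degree_monom_le] power_increasing)
  also have "\<dots> < ?q ^ (e * M)"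
    using q1 e M by (intro power_strict_increasing) auto
  finally have "P = 0"
    using card_frobenius_fixed[where 'a='a, of "e * M"] e M zero
    by (intro poly_eqI_degree[of "{x. x ^ ?q ^ (e * M) = x}" P 0])
      (simp_all add: P_def poly_sum poly_monom)
  then have "Polynomial.coeff P (?q ^ (e * i)) = 0" by simp
  moreover have "Polynomial.coeff P (?q ^ (e * i)) = (\<Sum>j<M. if j = i then c j else 0)"
    unfolding P_def Polynomial.coeff_sum using q1 e
    by (intro sum.cong refl) (simp add: power_inject_exp)
  ultimately show ?thesis using i by simp
qed

section \<open>Inverses of matrices\<close>

lemma matrix_inv_right: "A ** matrix_inv A = mat 1"
  and matrix_inv_left: "matrix_inv A ** A = mat 1"
  if "invertible A" for A :: "'k::semiring_1^'n^'n"
  using that unfolding invertible_def matrix_inv_def by (metis (mono_tags, lifting) someI_ex)+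

lemma invertible_matrix_inv: "invertible A \<Longrightarrow> invertible (matrix_inv A)"
  for A :: "'k::semiring_1^'n^'n"
  unfolding invertible_def using matrix_inv_right[of A] matrix_inv_left[of A]
  unfolding invertible_def by blast

lemma matrix_inv_cancel:
  fixes A :: "'k::semiring_1^'n^'n"
  assumes "invertible A"
  shows "A ** (matrix_inv A ** B) = B" "matrix_inv A ** (A ** B) = B"
    "(C ** A) ** matrix_inv A = C" "(C ** matrix_inv A) ** A = C"
  by (simp_all add: matrix_mul_assoc matrix_inv_left[OF assms] matrix_inv_right[OF assms])
     (simp_all add: matrix_inv_left[OF assms] matrix_inv_right[OF assms] flip: matrix_mul_assoc)

lemma matrix_inv_unique_left:
  fixes A B :: "'k::semiring_1^'n^'n"
  assumes "invertible A" "B ** A = mat 1"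
  shows "matrix_inv A = B"
  by (metis assms matrix_inv_cancel(3) matrix_mul_lid)

lemma matrix_inv_mult:
  fixes A B :: "'k::semiring_1^'n^'n"
  assumes "invertible A" "invertible B"
  shows "matrix_inv (A ** B) = matrix_inv B ** matrix_inv A"
  by (rule matrix_inv_unique_left)
    (simp_all add: assms invertible_mult matrix_inv_cancel matrix_inv_left flip: matrix_mul_assoc)

section \<open>The Frobenius map on matrices\<close>

lemma frob_funpow_nth: "(frob ^^ e) A $ i $ j = (A $ i $ j) ^ CARD('a) ^ e"
  for A :: "'a::{field,finite} alg_closure^'n^'m"
  by (induction e) (simp_all add: frob_def mult.commute[of "CARD('a)"] flip: power_mult)

lemma frob_funpow_mult: "(frob ^^ e) (A ** B) = (frob ^^ e) A ** (frob ^^ e) B"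
  for A :: "'a::{field,finite} alg_closure^'n^'m" and B :: "'a alg_closure^'p^'n"
  by (simp add: vec_eq_iff frob_funpow_nth matrix_matrix_mult_def frobenius_sum power_mult_distrib)

lemma frob_funpow_mat_1 [simp]: "(frob ^^ e) (mat 1 :: 'a::{field,finite} alg_closure^'n^'n) = mat 1"
  by (simp add: vec_eq_iff frob_funpow_nth mat_def zero_power)

lemma invertible_frob_funpow: "invertible A \<Longrightarrow> invertible ((frob ^^ e) A)"
  for A :: "'a::{field,finite} alg_closure^'n^'n"
  unfolding invertible_def by (metis frob_funpow_mult frob_funpow_mat_1)

lemma frob_funpow_matrix_inv:
  "invertible A \<Longrightarrow> (frob ^^ e) (matrix_inv A) = matrix_inv ((frob ^^ e) A)"
  for A :: "'a::{field,finite} alg_closure^'n^'n"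
  by (metis frob_funpow_mult frob_funpow_mat_1 invertible_frob_funpow matrix_inv_left matrix_inv_unique_left)

section \<open>Lang's theorem for the general linear group\<close>
lemma funpow_periodic:
  assumes "finite (range (\<lambda>i. (f ^^ i) x))" "inj f"
  shows "\<exists>m>0. (f ^^ m) x = x"
proof -
  have "\<not> inj (\<lambda>i. (f ^^ i) x)"
    using assms(1) finite_imageD by fastforce
  then obtain i j where ij: "i < j" "(f ^^ i) x = (f ^^ j) x"
    unfolding inj_def by (metis linorder_neqE_nat)
  then have "(f ^^ i) x = (f ^^ i) ((f ^^ (j - i)) x)"
    by (metis comp_apply funpow_add le_add_diff_inverse less_imp_le_nat)
  then have "(f ^^ (j - i)) x = x"
    using inj_fn[OF assms(2), of i] by (metis injD)
  then show ?thesis using ij(1) by (intro exI[of _ "j - i"]) simp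
qed

text \<open>
  The solutions of \<open>F(v) = v y\<close> are the fixed vectors of the semilinear map \<open>\<Phi>(v) = F(v) y\<inverse>\<close>. Every vector
  \<open>v\<close> has finite period \<open>M\<close> under \<open>\<Phi>\<close>, since \<open>\<Phi>\<close> is injective and preserves the vectors with entries in
  a large finite field. So for each \<open>x\<close> with \<open>x ^ (Q ^ M) = x\<close> the trace \<open>\<Sum>i<M. x ^ (Q ^ i) \<cdot> \<Phi>\<^sup>i(v)\<close> is a fixed
  vector. A linear functional that kills all these traces kills \<open>v\<close>, by the independence of
  the powers.
\<close>
lemma span_frobenius_eigenvectors:
  fixes y :: "'a::{field,finite} alg_closure^'n^'n"
  assumes y: "invertible y" and e: "0 < e"
  shows "vec.span {v. (\<chi> j. v $ j ^ CARD('a) ^ e) = v v* y} = UNIV"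
proof (rule ccontr)
  let ?q = "CARD('a)"
  define V where "V = {v. (\<chi> j. v $ j ^ ?q ^ e) = v v* y}"
  define yi where "yi = matrix_inv y"
  have yi: "y ** yi = mat 1" "yi ** y = mat 1"
    using y by (simp_all add: yi_def matrix_inv_left matrix_inv_right)
  define \<Phi> where "\<Phi> v = (\<chi> j. v $ j ^ ?q ^ e) v* yi" for v :: "'a alg_closure^'n"
  have V_iff: "v \<in> V \<longleftrightarrow> \<Phi> v = v" for v
    unfolding V_def \<Phi>_def mem_Collect_eq
    by (metis vector_matrix_mul_assoc vector_matrix_mul_rid yi)
  have nth: "\<Phi> v $ j = (\<Sum>l\<in>UNIV. v $ l ^ ?q ^ e * yi $ l $ j)" for v j
    by (simp add: \<Phi>_def vector_matrix_mult_def mult.commute)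
  have \<Phi>_sum: "\<Phi> (\<Sum>i\<in>I. c i *s w i) = (\<Sum>i\<in>I. c i ^ ?q ^ e *s \<Phi> (w i))"
    for I :: "nat set" and c w
  proof (rule vec_eq_iff[THEN iffD2, rule_format])
    fix j
    have "\<Phi> (\<Sum>i\<in>I. c i *s w i) $ j = (\<Sum>l\<in>UNIV. \<Sum>i\<in>I. c i ^ ?q ^ e * (w i $ l ^ ?q ^ e * yi $ l $ j))"
      by (simp add: nth frobenius_sum power_mult_distrib sum_distrib_right mult.assoc)
    also have "\<dots> = (\<Sum>i\<in>I. \<Sum>l\<in>UNIV. c i ^ ?q ^ e * (w i $ l ^ ?q ^ e * yi $ l $ j))"
      by (rule sum.swap)
    also have "\<dots> = (\<Sum>i\<in>I. c i ^ ?q ^ e *s \<Phi> (w i)) $ j"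
      by (simp add: nth sum_distrib_left)
    finally show "\<Phi> (\<Sum>i\<in>I. c i *s w i) $ j = (\<Sum>i\<in>I. c i ^ ?q ^ e *s \<Phi> (w i)) $ j" .
  qed
  have "inj \<Phi>"
  proof (rule injI)
    fix v w assume "\<Phi> v = \<Phi> w"
    then have "(\<chi> j. v $ j ^ ?q ^ e) = (\<chi> j. w $ j ^ ?q ^ e)"
      unfolding \<Phi>_def by (metis vector_matrix_mul_assoc vector_matrix_mul_rid yi(2))
    then show "v = w"
      by (auto simp: vec_eq_iff intro: frobenius_inj)
  qed
  assume "vec.span {v. (\<chi> j. v $ j ^ ?q ^ e) = v v* y} \<noteq> UNIV"
  then obtain v where v: "v \<notin> vec.span V"
    unfolding V_def by blast
  have periodic: "\<exists>m>0. (\<Phi> ^^ m) v = v"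
  proof (rule funpow_periodic[OF _ \<open>inj \<Phi>\<close>])
    obtain m where m: "0 < m" "\<forall>x \<in> range (($) v) \<union> (\<Union>l. range (($) (yi $ l))). x ^ ?q ^ m = x"
      using frobenius_common_period[of "range (($) v) \<union> (\<Union>l. range (($) (yi $ l)))"] by auto
    define E where "E = {x :: 'a alg_closure. x ^ ?q ^ m = x}"
    define W where "W = {w :: 'a alg_closure^'n. \<forall>j. w $ j \<in> E}"
    have "(\<Phi> ^^ i) v \<in> W" for i
    proof (induction i)
      case 0
      show ?case using m(2) by (auto simp: W_def E_def)
    next
      case (Suc i)
      have yiE: "yi $ l $ j ^ ?q ^ m = yi $ l $ j" for l j
        using bspec[OF m(2), of "yi $ l $ j"] by blast
      have "((\<Phi> ^^ i) v $ l ^ ?q ^ e) ^ ?q ^ m = (\<Phi> ^^ i) v $ l ^ ?q ^ e" for l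
      proof -
        have "(\<Phi> ^^ i) v $ l ^ ?q ^ m = (\<Phi> ^^ i) v $ l"
          using Suc by (simp add: W_def E_def)
        then show ?thesis
          by (subst power_mult[symmetric], subst mult.commute, simp only: power_mult)
      qed
      then show ?case
        by (simp add: W_def E_def nth frobenius_sum power_mult_distrib yiE)
    qed
    moreover have "finite W"
    proof -
      have "W \<subseteq> (\<lambda>f. \<chi> j. f j) ` (UNIV \<rightarrow>\<^sub>E E)"
      proof
        fix w assume "w \<in> W"
        then show "w \<in> (\<lambda>f. \<chi> j. f j) ` (UNIV \<rightarrow>\<^sub>E E)"
          by (intro image_eqI[of _ _ "($) w"]) (auto simp: W_def)
      qed
      then show ?thesis
        using card_frobenius_fixed(1)[OF m(1), where 'a='a]
        by (elim finite_subset) (simp add: E_def finite_PiE)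
    qed
    ultimately show "finite (range (\<lambda>i. (\<Phi> ^^ i) v))"
      by (meson finite_subset image_subsetI)
  qed
  then obtain M where M: "0 < M" "(\<Phi> ^^ M) v = v"
    by blast
  define T where "T x = (\<Sum>i<M. x ^ ?q ^ (e * i) *s (\<Phi> ^^ i) v)" for x
  \<comment> \<open>\<open>\<Phi>\<close> shifts the summands of \<open>T x\<close> by one, and the summand that falls off at \<open>M\<close> equals the one at \<open>0\<close>.\<close>
  have TV: "T x \<in> V" if "x ^ ?q ^ (e * M) = x" for x
  proof -
    let ?t = "\<lambda>i. x ^ ?q ^ (e * i) *s (\<Phi> ^^ i) v"
    have "\<Phi> (T x) = (\<Sum>i<M. ?t (Suc i))"
      unfolding T_def \<Phi>_sum by (simp add: power_add flip: power_mult) (simp add: mult.commute)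
    moreover have "?t 0 = ?t M"
      using that M by simp
    ultimately have "\<Phi> (T x) = T x"
      using sum.lessThan_Suc_shift[of ?t M] sum.lessThan_Suc[of ?t M] by (simp add: T_def)
    then show ?thesis by (simp add: V_iff)
  qed
  obtain B where B: "B \<subseteq> V" "vec.independent B" "V \<subseteq> vec.span B"
    by (metis vec.basis_exists)
  have "v \<notin> vec.span B"
    using v B(1) vec.span_mono by blast
  then have ind: "vec.independent (insert v B)"
    using B(2) by (simp add: vec.independent_insert)
  \<comment> \<open>A linear functional that vanishes on the solutions but not at \<open>v\<close>, realised as a coordinate of \<open>f\<close>.\<close>
  obtain f where f: "Vector_Spaces.linear (*s) (*s) f" "\<forall>x\<in>insert v B. f x = (if x = v then v else 0)"
    using vec.linear_independent_extend[OF ind, of "\<lambda>x. if x = v then v else 0"] by blast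
  interpret f: Vector_Spaces.linear "(*s)" "(*s)" f by (rule f(1))
  have "f b = 0" if "b \<in> B" for b
    using f(2) that \<open>v \<notin> vec.span B\<close> vec.span_base by auto
  then have fV: "f w = 0" if "w \<in> V" for w
    using f.eq_0_on_span[of B w] that B(3) by auto
  have "v \<noteq> 0"
    using v vec.span_zero by auto
  then obtain j where j: "v $ j \<noteq> 0"
    by (auto simp: vec_eq_iff)
  have "(\<Sum>i<M. f ((\<Phi> ^^ i) v) $ j * x ^ ?q ^ (e * i)) = 0" if "x ^ ?q ^ (e * M) = x" for x
  proof -
    have "0 = f (T x) $ j"
      using fV[OF TV[OF that]] by simp
    also have "\<dots> = (\<Sum>i<M. f ((\<Phi> ^^ i) v) $ j * x ^ ?q ^ (e * i))"
      unfolding T_def f.sum f.scale by (simp add: sum_component mult.commute)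
    finally show ?thesis by simp
  qed
  then have "f ((\<Phi> ^^ 0) v) $ j = 0"
    using frobenius_powers_independent[OF e M(1), where c="\<lambda>i. f ((\<Phi> ^^ i) v) $ j"] M(1) by blast
  then show False
    using f(2) j by simp
qed

text \<open>
  A basis of row vectors that solve \<open>F(v) = v y\<close> gives the rows of \<open>a\<close>.
\<close>
lemma lang_GL:
  fixes y :: "'a::{field,finite} alg_closure^'n^'n"
  assumes y: "invertible y" and e: "0 < e"
  shows "\<exists>a :: 'a alg_closure^'n^'n. invertible a \<and> (frob ^^ e) a = a ** y"
proof -
  define V where "V = {v. (\<chi> j. v $ j ^ CARD('a) ^ e) = v v* y}"
  obtain B where B: "B \<subseteq> V" "vec.independent B" "V \<subseteq> vec.span B"
    by (metis vec.basis_exists)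
  have "vec.span V = UNIV"
    unfolding V_def by (rule span_frobenius_eigenvectors[OF assms])
  then have span: "vec.span B = UNIV"
    using vec.span_minimal[OF B(3) vec.subspace_span] by blast
  then have "card B = CARD('n)"
    using vec.dim_eq_card_independent[OF B(2)] vec.dim_span[of B] by (simp add: card_cart_basis)
  moreover have "finite B"
    using B(2) vec.finiteI_independent by blast
  ultimately obtain h :: "'n \<Rightarrow> _" where h: "bij_betw h UNIV B"
    using finite_same_card_bij[of "UNIV :: 'n set" B] by auto
  define a where "a = (\<chi> i. h i)"
  have "rows a = B"
    using h by (auto simp: rows_def row_def a_def bij_betw_def)
  then have "invertible a"
    using span by (simp add: invertible_left_inverse matrix_left_invertible_span_rows_gen)
  moreover have "h i \<in> V" for i
    using h B(1) by (auto simp: bij_betw_def)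
  then have "(frob ^^ e) a = a ** y"
    by (simp add: V_def vec_eq_iff frob_funpow_nth a_def matrix_matrix_mult_def vector_matrix_mult_def mult.commute)
  ultimately show ?thesis by blast
qed

section \<open>Polynomial functions and closed sets\<close>

lemma polyfuns_sum:
  "(\<And>x. x \<in> I \<Longrightarrow> p x \<in> polyfuns UNIV) \<Longrightarrow> (\<lambda>A. \<Sum>x\<in>I. p x A) \<in> polyfuns UNIV"
  by (induction I rule: infinite_finite_induct) (auto intro: polyfuns.intros)

lemma polyfuns_prod:
  "(\<And>x. x \<in> I \<Longrightarrow> p x \<in> polyfuns UNIV) \<Longrightarrow> (\<lambda>A. \<Prod>x\<in>I. p x A) \<in> polyfuns UNIV"
  by (induction I rule: infinite_finite_induct) (auto intro: polyfuns.intros)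

lemma polyfuns_det: "det \<in> polyfuns UNIV"
proof -
  have "(\<lambda>A. \<Sum>p | p permutes UNIV. of_int (sign p) * (\<Prod>i\<in>UNIV. A $ i $ p i)) \<in> polyfuns UNIV"
    by (intro polyfuns_sum polyfuns.mult polyfuns.const polyfuns_prod polyfuns.entry) simp
  then show ?thesis
    by (simp add: det_def[abs_def])
qed

lemma polyfuns_comp_mult_left:
  "p \<in> polyfuns UNIV \<Longrightarrow> (\<lambda>A. p (c ** A)) \<in> polyfuns UNIV"
proof (induction rule: polyfuns.induct)
  case (entry i j)
  show ?case
    unfolding matrix_matrix_mult_def by (simp add: polyfuns_sum polyfuns.intros)
qed (auto intro: polyfuns.intros)

lemma polyfuns_separate:
  fixes v :: "'k::field^'n^'m"
  assumes "finite V" "v \<notin> V"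
  shows "\<exists>p \<in> polyfuns UNIV. p v = 1 \<and> (\<forall>w\<in>V. p w = 0)"
  using assms
proof induction
  case empty
  have "(\<lambda>A. 1) \<in> polyfuns UNIV" by (rule polyfuns.const) simp
  then show ?case by force
next
  case (insert w V)
  obtain p where p: "p \<in> polyfuns UNIV" "p v = 1" "\<forall>u\<in>V. p u = 0"
    using insert by auto
  obtain i j where ij: "v $ i $ j \<noteq> w $ i $ j"
    using insert.prems by (auto simp: vec_eq_iff)
  define r where "r A = inverse (v $ i $ j - w $ i $ j) * (A $ i $ j + - w $ i $ j)" for A :: "'k^'n^'m"
  have "r \<in> polyfuns UNIV"
    unfolding r_def[abs_def] by (intro polyfuns.intros) simp_all
  moreover have "r v = 1" "r w = 0"
    using ij by (simp_all add: r_def)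
  ultimately show ?case
    using p by (intro bexI[of _ "\<lambda>A. r A * p A"] polyfuns.mult) auto
qed

text \<open>
  Closed subsets of the general linear group for the Zariski topology, in terms of equations. This form is
  easier to transport along maps than closedness in the subspace topology.
\<close>
definition closed_in_GL :: "('k::field^'n^'n) set \<Rightarrow> bool" where
  "closed_in_GL Z \<longleftrightarrow> (\<exists>P \<subseteq> polyfuns UNIV. Z = {A. invertible A \<and> (\<forall>p\<in>P. p A = 0)})"

lemma closed_in_GL_Un:
  assumes "closed_in_GL Y" "closed_in_GL Z"
  shows "closed_in_GL (Y \<union> Z)"
proof -
  obtain P R where P: "P \<subseteq> polyfuns UNIV" "Y = {A. invertible A \<and> (\<forall>p\<in>P. p A = 0)}"
    and R: "R \<subseteq> polyfuns UNIV" "Z = {A. invertible A \<and> (\<forall>p\<in>R. p A = 0)}"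
    using assms unfolding closed_in_GL_def by blast
  define S where "S = (\<lambda>(p, r) A. p A * r A) ` (P \<times> R)"
  have "S \<subseteq> polyfuns UNIV"
    using P(1) R(1) by (auto simp: S_def intro!: polyfuns.mult)
  moreover have "(\<forall>s\<in>S. s A = 0) \<longleftrightarrow> (\<forall>p\<in>P. p A = 0) \<or> (\<forall>r\<in>R. r A = 0)" for A
    by (auto simp: S_def)
  then have "Y \<union> Z = {A. invertible A \<and> (\<forall>s\<in>S. s A = 0)}"
    unfolding P(2) R(2) by auto
  ultimately show ?thesis
    unfolding closed_in_GL_def by blast
qed

lemma closed_in_GL_empty: "closed_in_GL {}"
proof -
  have "(\<lambda>A. 1) \<in> polyfuns UNIV" by (rule polyfuns.const) simp
  then show ?thesis
    unfolding closed_in_GL_def by (intro exI[of _ "{\<lambda>A. 1}"]) auto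
qed

lemma closed_in_GL_UN:
  "finite I \<Longrightarrow> (\<And>i. i \<in> I \<Longrightarrow> closed_in_GL (Z i)) \<Longrightarrow> closed_in_GL (\<Union>i\<in>I. Z i)"
  by (induction rule: finite_induct) (auto intro: closed_in_GL_Un closed_in_GL_empty)

lemma closed_in_GL_translate:
  assumes "closed_in_GL Z" and c: "invertible c"
  shows "closed_in_GL ((**) c ` Z)"
proof -
  obtain P where P: "P \<subseteq> polyfuns UNIV" "Z = {A. invertible A \<and> (\<forall>p\<in>P. p A = 0)}"
    using assms unfolding closed_in_GL_def by blast
  define R where "R = (\<lambda>p A. p (matrix_inv c ** A)) ` P"
  have "R \<subseteq> polyfuns UNIV"
    using P(1) by (auto simp: R_def intro!: polyfuns_comp_mult_left)
  moreover have "(**) c ` Z = {A. invertible A \<and> (\<forall>r\<in>R. r A = 0)}"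
  proof (intro equalityI subsetI)
    fix A assume "A \<in> (**) c ` Z"
    then show "A \<in> {A. invertible A \<and> (\<forall>r\<in>R. r A = 0)}"
      using c by (auto simp: P(2) R_def matrix_inv_cancel invertible_mult)
  next
    fix A assume A: "A \<in> {A. invertible A \<and> (\<forall>r\<in>R. r A = 0)}"
    then have "matrix_inv c ** A \<in> Z"
      using c by (auto simp: P(2) R_def invertible_mult invertible_matrix_inv)
    then show "A \<in> (**) c ` Z"
      using c by (intro image_eqI[of _ _ "matrix_inv c ** A"]) (simp_all add: matrix_inv_cancel)
  qed
  ultimately show ?thesis
    unfolding closed_in_GL_def by blast
qed

section \<open>Reduction of polynomials along the fibres of the Lang map\<close>

definition monomial_fun :: "('m \<times> 'n \<Rightarrow> nat) \<Rightarrow> 'k::comm_ring_1^'n^'m \<Rightarrow> 'k" where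
  "monomial_fun \<epsilon> s = (\<Prod>x\<in>UNIV. s $ fst x $ snd x ^ \<epsilon> x)"

definition reduced_exponents :: "nat \<Rightarrow> ('m \<times> 'n \<Rightarrow> nat) set" where
  "reduced_exponents Q = {\<epsilon>. \<forall>x. \<epsilon> x < Q}"

lemma card_reduced_exponents:
  "finite (reduced_exponents Q :: ('m::finite \<times> 'n::finite \<Rightarrow> nat) set)"
  "card (reduced_exponents Q :: ('m \<times> 'n \<Rightarrow> nat) set) = Q ^ (CARD('m) * CARD('n))"
proof -
  have eq: "reduced_exponents Q = (UNIV :: ('m \<times> 'n) set) \<rightarrow>\<^sub>E {..<Q}"
    by (auto simp: reduced_exponents_def PiE_def extensional_def)
  show "finite (reduced_exponents Q :: ('m \<times> 'n \<Rightarrow> nat) set)"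
    unfolding eq by (intro finite_PiE) auto
  show "card (reduced_exponents Q :: ('m \<times> 'n \<Rightarrow> nat) set) = Q ^ (CARD('m) * CARD('n))"
    unfolding eq by (subst card_PiE) (simp_all add: card_prod)
qed

text \<open>
  The relation \<open>(\<chi> i j. s $ i $ j ^ Q) = s ** b\<close> describes the graph of the Lang map \<open>s \<mapsto> b\<close>. On it, the
  ring of polynomials in \<open>s\<close> is to be generated, as a module over the polynomials in \<open>b\<close>, by the reduced
  monomials; the predicate says that \<open>r\<close> belongs to that module. Matrices \<open>s\<close> that are not invertible are included,
  since only then do the solutions for a given \<open>b\<close> match the reduced monomials in number.
\<close>

definition reducible_fun :: "nat \<Rightarrow> ('k::comm_ring_1^'n^'n \<Rightarrow> 'k^'n^'n \<Rightarrow> 'k) \<Rightarrow> bool" where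
  "reducible_fun Q r \<longleftrightarrow> (\<exists>g. (\<forall>\<epsilon>. g \<epsilon> \<in> polyfuns UNIV) \<and>
     (\<forall>s b. (\<chi> i j. s $ i $ j ^ Q) = s ** b \<longrightarrow>
        r s b = (\<Sum>\<epsilon>\<in>reduced_exponents Q. g \<epsilon> b * monomial_fun \<epsilon> s)))"

lemma reducible_fun_cong:
  assumes "reducible_fun Q r"
    and "\<And>s b. (\<chi> i j. s $ i $ j ^ Q) = s ** b \<Longrightarrow> r' s b = r s b"
  shows "reducible_fun Q r'"
  using assms unfolding reducible_fun_def by simp

lemma reducible_fun_scale:
  assumes "reducible_fun Q r" and p: "p \<in> polyfuns UNIV"
  shows "reducible_fun Q (\<lambda>s b. p b * r s b)"
proof -
  obtain g where g: "\<forall>\<epsilon>. g \<epsilon> \<in> polyfuns UNIV"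
    "\<forall>s b. (\<chi> i j. s $ i $ j ^ Q) = s ** b \<longrightarrow>
        r s b = (\<Sum>\<epsilon>\<in>reduced_exponents Q. g \<epsilon> b * monomial_fun \<epsilon> s)"
    using assms(1) unfolding reducible_fun_def by blast
  show ?thesis
    unfolding reducible_fun_def
    using g p by (intro exI[of _ "\<lambda>\<epsilon> b. p b * g \<epsilon> b"])
      (auto intro: polyfuns.mult simp: sum_distrib_left mult.assoc)
qed

lemma reducible_fun_add:
  assumes "reducible_fun Q r" "reducible_fun Q r'"
  shows "reducible_fun Q (\<lambda>s b. r s b + r' s b)"
proof -
  obtain g where g: "\<forall>\<epsilon>. g \<epsilon> \<in> polyfuns UNIV"
    "\<forall>s b. (\<chi> i j. s $ i $ j ^ Q) = s ** b \<longrightarrow>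
        r s b = (\<Sum>\<epsilon>\<in>reduced_exponents Q. g \<epsilon> b * monomial_fun \<epsilon> s)"
    using assms(1) unfolding reducible_fun_def by blast
  obtain g' where g': "\<forall>\<epsilon>. g' \<epsilon> \<in> polyfuns UNIV"
    "\<forall>s b. (\<chi> i j. s $ i $ j ^ Q) = s ** b \<longrightarrow>
        r' s b = (\<Sum>\<epsilon>\<in>reduced_exponents Q. g' \<epsilon> b * monomial_fun \<epsilon> s)"
    using assms(2) unfolding reducible_fun_def by blast
  show ?thesis
    unfolding reducible_fun_def
    using g g' by (intro exI[of _ "\<lambda>\<epsilon> b. g \<epsilon> b + g' \<epsilon> b"])
      (auto intro: polyfuns.add simp: sum.distrib distrib_right)
qed

lemma reducible_fun_0: "reducible_fun Q (\<lambda>s b. 0)"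
  unfolding reducible_fun_def
  by (intro exI[of _ "\<lambda>\<epsilon> b. 0"]) (auto intro: polyfuns.const)

lemma reducible_fun_sum:
  "(\<And>x. x \<in> I \<Longrightarrow> reducible_fun Q (r x)) \<Longrightarrow> reducible_fun Q (\<lambda>s b. \<Sum>x\<in>I. r x s b)"
  by (induction I rule: infinite_finite_induct) (auto intro: reducible_fun_0 reducible_fun_add)

lemma reducible_fun_monomial:
  fixes \<epsilon> :: "'n::finite \<times> 'n \<Rightarrow> nat"
  assumes "\<epsilon> \<in> reduced_exponents Q"
  shows "reducible_fun Q (\<lambda>s b. monomial_fun \<epsilon> s :: 'k::comm_ring_1)"
proof -
  have "(\<Sum>\<delta>\<in>reduced_exponents Q. (if \<delta> = \<epsilon> then 1 else 0) * monomial_fun \<delta> s) = monomial_fun \<epsilon> s"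
    for s :: "'k^'n^'n"
    using assms card_reduced_exponents(1)[where 'm='n and 'n='n, of Q]
    by (simp add: if_distrib[of "\<lambda>x. x * _"] cong: if_cong)
  then show ?thesis
    unfolding reducible_fun_def
    by (intro exI[of _ "\<lambda>\<delta> b. if \<delta> = \<epsilon> then 1 else 0"]) (auto intro: polyfuns.const)
qed

lemma monomial_fun_split:
  "monomial_fun \<epsilon> s = s $ i $ j ^ \<epsilon> (i, j) * monomial_fun (\<epsilon>((i, j) := 0)) s"
proof -
  let ?R = "\<Prod>x\<in>UNIV - {(i, j)}. s $ fst x $ snd x ^ \<epsilon> x"
  have "monomial_fun \<epsilon> s = s $ i $ j ^ \<epsilon> (i, j) * ?R"
    unfolding monomial_fun_def by (subst prod.remove[of _ "(i, j)"]) auto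
  moreover have "monomial_fun (\<epsilon>((i, j) := 0)) s = ?R"
    unfolding monomial_fun_def by (subst prod.remove[of _ "(i, j)"]) (auto intro: prod.cong)
  ultimately show ?thesis by simp
qed

text \<open>
  If the product is no longer reduced, it contains \<open>s $ i $ j ^ Q\<close>, which the relation replaces by
  the linear form \<open>\<Sum>l. s $ i $ l * b $ l $ j\<close>. This lowers the degree by \<open>Q - 1 > 0\<close>, so induction on the degree
  applies.
\<close>
lemma reducible_fun_entry_monomial:
  fixes \<epsilon> :: "'n::finite \<times> 'n \<Rightarrow> nat"
  assumes Q: "1 < Q" and \<epsilon>: "\<epsilon> \<in> reduced_exponents Q"
  shows "reducible_fun Q (\<lambda>s b. s $ i $ j * monomial_fun \<epsilon> s :: 'k::comm_ring_1)"
  using \<epsilon>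
proof (induction "\<Sum>x\<in>UNIV. \<epsilon> x" arbitrary: \<epsilon> i j rule: less_induct)
  case less
  let ?x = "(i, j)" and ?\<epsilon>0 = "\<epsilon>((i, j) := 0)"
  show ?case
  proof (cases "Suc (\<epsilon> ?x) < Q")
    case True
    let ?\<epsilon>' = "\<epsilon>(?x := Suc (\<epsilon> ?x))"
    have "?\<epsilon>' \<in> reduced_exponents Q"
      using True less.prems by (auto simp: reduced_exponents_def)
    moreover have "s $ i $ j * monomial_fun \<epsilon> s = monomial_fun ?\<epsilon>' s" for s :: "'k^'n^'n"
      using monomial_fun_split[of \<epsilon> s i j] monomial_fun_split[of ?\<epsilon>' s i j] by simp
    ultimately show ?thesis
      using reducible_fun_monomial by simp
  next
    case False
    then have top: "Suc (\<epsilon> ?x) = Q"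
      using less.prems unfolding reduced_exponents_def by (simp add: not_less le_antisym Suc_le_eq)
    have red: "?\<epsilon>0 \<in> reduced_exponents Q"
      using less.prems Q by (auto simp: reduced_exponents_def)
    have "(\<Sum>x\<in>UNIV. ?\<epsilon>0 x) < (\<Sum>x\<in>UNIV. \<epsilon> x)"
      using top Q by (intro sum_strict_mono_ex1) auto
    then have IH: "reducible_fun Q (\<lambda>s b. s $ i $ l * monomial_fun ?\<epsilon>0 s :: 'k)" for l
      using less.hyps red by blast
    have "reducible_fun Q (\<lambda>s b. \<Sum>l\<in>UNIV. b $ l $ j * (s $ i $ l * monomial_fun ?\<epsilon>0 s :: 'k))"
      by (intro reducible_fun_sum reducible_fun_scale IH polyfuns.entry)
    then show ?thesis
    proof (rule reducible_fun_cong)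
      fix s b :: "'k^'n^'n"
      assume "(\<chi> i j. s $ i $ j ^ Q) = s ** b"
      then have "s $ i $ j ^ Q = (\<Sum>l\<in>UNIV. s $ i $ l * b $ l $ j)"
        by (simp add: vec_eq_iff matrix_matrix_mult_def)
      moreover have "s $ i $ j * monomial_fun \<epsilon> s = s $ i $ j ^ Q * monomial_fun ?\<epsilon>0 s"
        using monomial_fun_split[of \<epsilon> s i j] by (simp flip: top)
      ultimately show "s $ i $ j * monomial_fun \<epsilon> s =
          (\<Sum>l\<in>UNIV. b $ l $ j * (s $ i $ l * monomial_fun ?\<epsilon>0 s))"
        by (simp add: sum_distrib_left sum_distrib_right mult_ac)
    qed
  qed
qed

lemma reducible_fun_entry:
  fixes r :: "'k::comm_ring_1^'n^'n \<Rightarrow> 'k^'n^'n \<Rightarrow> 'k"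
  assumes Q: "1 < Q" and r: "reducible_fun Q r"
  shows "reducible_fun Q (\<lambda>s b. s $ i $ j * r s b)"
proof -
  obtain g where g: "\<forall>\<epsilon>. g \<epsilon> \<in> polyfuns UNIV"
    "\<forall>s b. (\<chi> i j. s $ i $ j ^ Q) = s ** b \<longrightarrow>
        r s b = (\<Sum>\<epsilon>\<in>reduced_exponents Q. g \<epsilon> b * monomial_fun \<epsilon> s)"
    using r unfolding reducible_fun_def by blast
  have "reducible_fun Q (\<lambda>s b. \<Sum>\<epsilon>\<in>reduced_exponents Q. g \<epsilon> b * (s $ i $ j * monomial_fun \<epsilon> s))"
    using g(1) by (intro reducible_fun_sum reducible_fun_scale reducible_fun_entry_monomial Q) auto
  then show ?thesis
    by (rule reducible_fun_cong) (simp add: g(2) sum_distrib_left mult_ac)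
qed

lemma reducible_fun_polyfun:
  fixes p :: "'k::comm_ring_1^'n^'n \<Rightarrow> 'k"
  assumes Q: "1 < Q" and p: "p \<in> polyfuns UNIV"
  shows "reducible_fun Q (\<lambda>s b. p s)"
proof -
  \<comment> \<open>Stated with a factor \<open>r\<close> so that products of polynomials go through the induction.\<close>
  have "reducible_fun Q r \<Longrightarrow> reducible_fun Q (\<lambda>s b. p s * r s b)" for r
    using p
  proof (induction arbitrary: r rule: polyfuns.induct)
    case (const c)
    then show ?case by (intro reducible_fun_scale[where p="\<lambda>_. c"] polyfuns.const) auto
  next
    case (entry i j)
    then show ?case by (rule reducible_fun_entry[OF Q])
  next
    case (add p p')
    then show ?case by (simp add: distrib_right reducible_fun_add)
  next
    case (mult p p')
    then show ?case by (simp add: mult.assoc)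
  qed
  moreover have "reducible_fun Q (\<lambda>s b. monomial_fun (\<lambda>x. 0) s :: 'k)"
    using Q by (intro reducible_fun_monomial) (simp add: reduced_exponents_def)
  ultimately show ?thesis
    by (fastforce simp: monomial_fun_def)
qed

lemma sum_fun_apply: "(\<Sum>x\<in>I. f x) y = (\<Sum>x\<in>I. f x y)"
  for f :: "'b \<Rightarrow> 'c \<Rightarrow> 'd::comm_monoid_add"
  by (induction I rule: infinite_finite_induct) simp_all

text \<open>
  By interpolation every function on the finite set \<open>V\<close> is the restriction of a polynomial, hence of a
  combination of reduced monomials. There are exactly as many reduced monomials as points of \<open>V\<close>, so a
  linear relation between them would leave too few to span all functions.
\<close>
lemma reduced_monomials_independent:
  fixes V :: "('k::field^'n^'n) set" and \<gamma> :: "('n \<times> 'n \<Rightarrow> nat) \<Rightarrow> 'k"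
  assumes Q: "1 < Q" and V: "finite V" "card V = Q ^ (CARD('n) * CARD('n))"
    and b: "\<And>s. s \<in> V \<Longrightarrow> (\<chi> i j. s $ i $ j ^ Q) = s ** b"
    and zero: "\<And>s. s \<in> V \<Longrightarrow> (\<Sum>\<epsilon>\<in>reduced_exponents Q. \<gamma> \<epsilon> * monomial_fun \<epsilon> s) = 0"
    and \<epsilon>: "\<epsilon> \<in> reduced_exponents Q"
  shows "\<gamma> \<epsilon> = 0"
proof (rule ccontr)
  assume \<gamma>: "\<gamma> \<epsilon> \<noteq> 0"
  let ?E = "reduced_exponents Q :: ('n \<times> 'n \<Rightarrow> nat) set"
  interpret fv: vector_space "\<lambda>(c :: 'k) (f :: 'k^'n^'n \<Rightarrow> 'k) x. c * f x"
    by unfold_locales (auto simp: fun_eq_iff algebra_simps)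
  define m where "m \<delta> s = (if s \<in> V then monomial_fun \<delta> s else 0)" for \<delta> :: "'n \<times> 'n \<Rightarrow> nat" and s
  define d where "d v s = (if s = v then 1 else 0 :: 'k)" for v s :: "'k^'n^'n"
  have inj_d: "inj_on d V"
    by (auto simp: inj_on_def d_def fun_eq_iff)
  have "fv.independent (d ` V)"
  proof (rule fv.independent_if_scalars_zero)
    show "finite (d ` V)" using V(1) by simp
    fix u w assume u: "(\<Sum>f\<in>d ` V. (\<lambda>x. u f * f x)) = 0" and "w \<in> d ` V"
    then obtain v where v: "v \<in> V" "w = d v" by blast
    have "0 = (\<Sum>f\<in>d ` V. (\<lambda>x. u f * f x)) v"
      by (simp only: u zero_fun_def)
    also have "\<dots> = (\<Sum>s\<in>V. u (d s) * d s v)"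
      unfolding sum_fun_apply by (subst sum.reindex[OF inj_d]) simp
    also have "\<dots> = u (d v)"
      using v(1) V(1) by (simp add: d_def if_distrib[of "\<lambda>x. _ * x"] cong: if_cong)
    finally show "u w = 0" using v(2) by simp
  qed
  moreover have "d ` V \<subseteq> fv.span (m ` (?E - {\<epsilon>}))"
  proof
    fix f assume "f \<in> d ` V"
    then obtain v where v: "v \<in> V" "f = d v" by blast
    obtain p where p: "p \<in> polyfuns UNIV" "p v = 1" "\<forall>w\<in>V - {v}. p w = 0"
      using polyfuns_separate[of "V - {v}" v] V(1) by auto
    obtain g where g: "\<forall>s b. (\<chi> i j. s $ i $ j ^ Q) = s ** b \<longrightarrow>
        p s = (\<Sum>\<delta>\<in>?E. g \<delta> b * monomial_fun \<delta> s)"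
      using reducible_fun_polyfun[OF Q p(1)] unfolding reducible_fun_def by blast
    \<comment> \<open>The coefficients after eliminating the monomial \<open>\<epsilon>\<close> by means of the relation \<open>\<gamma>\<close>.\<close>
    define c where "c \<delta> = g \<delta> b - g \<epsilon> b * \<gamma> \<delta> / \<gamma> \<epsilon>" for \<delta>
    have "f = (\<Sum>\<delta>\<in>?E - {\<epsilon>}. (\<lambda>x. c \<delta> * m \<delta> x))"
    proof
      fix s
      show "f s = (\<Sum>\<delta>\<in>?E - {\<epsilon>}. (\<lambda>x. c \<delta> * m \<delta> x)) s"
      proof (cases "s \<in> V")
        case True
        have "(\<Sum>\<delta>\<in>?E - {\<epsilon>}. c \<delta> * monomial_fun \<delta> s) = (\<Sum>\<delta>\<in>?E. c \<delta> * monomial_fun \<delta> s)"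
          using \<gamma> \<epsilon> card_reduced_exponents(1)[where 'm='n and 'n='n, of Q]
          by (subst (2) sum.remove[of _ \<epsilon>]) (simp_all add: c_def)
        also have "\<dots> = (\<Sum>\<delta>\<in>?E. g \<delta> b * monomial_fun \<delta> s) -
            g \<epsilon> b / \<gamma> \<epsilon> * (\<Sum>\<delta>\<in>?E. \<gamma> \<delta> * monomial_fun \<delta> s)"
          by (simp add: c_def sum_distrib_left sum_subtractf algebra_simps)
        also have "\<dots> = p s"
          using g b[OF True] zero[OF True] by simp
        also have "\<dots> = f s"
          using True v p by (auto simp: d_def)
        finally show ?thesis
          using True by (simp add: sum_fun_apply m_def)
      next
        case False
        then show ?thesis
          using v by (auto simp: sum_fun_apply m_def d_def)
      qed
    qed
    also have "\<dots> \<in> fv.span (m ` (?E - {\<epsilon>}))"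
      by (intro fv.span_sum fv.span_scale fv.span_base imageI)
    finally show "f \<in> fv.span (m ` (?E - {\<epsilon>}))" .
  qed
  ultimately have "card (d ` V) \<le> card (m ` (?E - {\<epsilon>}))"
    using card_reduced_exponents(1)[where 'm='n and 'n='n, of Q]
    by (intro fv.independent_span_bound[THEN conjunct2]) auto
  also have "\<dots> \<le> card (?E - {\<epsilon>})"
    using card_reduced_exponents(1)[where 'm='n and 'n='n, of Q] by (intro card_image_le) auto
  also have "\<dots> < card ?E"
    using \<epsilon> card_reduced_exponents(1)[where 'm='n and 'n='n, of Q] by (intro psubset_card_mono) auto
  finally show False
    by (simp add: card_image[OF inj_d] V(2) card_reduced_exponents(2))
qed

section \<open>The Lang map\<close>

definition lang_map :: "nat \<Rightarrow> 'a::{field,finite} alg_closure^'n^'n \<Rightarrow> 'a alg_closure^'n^'n" where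
  "lang_map e a = matrix_inv a ** (frob ^^ e) a"

definition fixed_GL :: "nat \<Rightarrow> ('a::{field,finite} alg_closure^'n^'n) set" where
  "fixed_GL e = {c. invertible c \<and> (frob ^^ e) c = c}"

lemma card_fixed_matrices:
  assumes e: "0 < e"
  shows "finite {c :: 'a::{field,finite} alg_closure^'n^'n. (frob ^^ e) c = c}"
    and "card {c :: 'a alg_closure^'n^'n. (frob ^^ e) c = c} = (CARD('a) ^ e) ^ (CARD('n) * CARD('n))"
proof -
  let ?E = "{x :: 'a alg_closure. x ^ CARD('a) ^ e = x}"
  let ?C = "{c :: 'a alg_closure^'n^'n. (frob ^^ e) c = c}"
  have bij: "bij_betw (\<lambda>f. \<chi> i j. f (i, j)) ((UNIV :: ('n \<times> 'n) set) \<rightarrow>\<^sub>E ?E) ?C"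
    by (rule bij_betwI[where g="\<lambda>c x. c $ fst x $ snd x"])
      (auto simp: vec_eq_iff frob_funpow_nth PiE_def Pi_def extensional_def)
  have "finite ((UNIV :: ('n \<times> 'n) set) \<rightarrow>\<^sub>E ?E)"
    by (intro finite_PiE card_frobenius_fixed(1)[OF e]) simp
  then show "finite ?C"
    using bij_betw_finite[OF bij] by simp
  show "card ?C = (CARD('a) ^ e) ^ (CARD('n) * CARD('n))"
    unfolding bij_betw_same_card[OF bij, symmetric]
    by (subst card_PiE) (simp_all add: card_frobenius_fixed(2)[OF e] card_prod)
qed

lemma finite_fixed_GL: "0 < e \<Longrightarrow> finite (fixed_GL e)"
  by (rule finite_subset[OF _ card_fixed_matrices(1)]) (auto simp: fixed_GL_def)

lemma lang_map_eq_iff: "invertible a \<Longrightarrow> lang_map e a = b \<longleftrightarrow> (frob ^^ e) a = a ** b"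
  unfolding lang_map_def by (metis matrix_inv_cancel(1,2))

lemma invertible_lang_map: "invertible a \<Longrightarrow> invertible (lang_map e a)"
  unfolding lang_map_def by (simp add: invertible_mult invertible_matrix_inv invertible_frob_funpow)

lemma lang_map_mult:
  assumes "invertible a" "invertible b"
  shows "lang_map e (a ** b) = matrix_inv b ** lang_map e a ** (frob ^^ e) b"
  unfolding lang_map_def using assms by (simp add: matrix_inv_mult frob_funpow_mult matrix_mul_assoc)

lemma lang_map_fixed_mult:
  assumes "c \<in> fixed_GL e" "invertible a"
  shows "lang_map e (c ** a) = lang_map e a"
proof -
  have "lang_map e c = mat 1"
    using assms by (simp add: fixed_GL_def lang_map_def matrix_inv_left)
  moreover have "lang_map e (c ** a) = matrix_inv a ** lang_map e c ** (frob ^^ e) a"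
    using assms by (intro lang_map_mult) (simp_all add: fixed_GL_def)
  ultimately show ?thesis
    by (simp add: lang_map_def[of e a])
qed

lemma lang_map_fibre:
  assumes "invertible a" "invertible a'" "lang_map e a = lang_map e a'"
  shows "a' ** matrix_inv a \<in> fixed_GL e"
proof -
  define b where "b = lang_map e a"
  have "(frob ^^ e) a = a ** b" "(frob ^^ e) a' = a' ** b"
    using assms b_def lang_map_eq_iff by metis+
  moreover have "invertible b"
    unfolding b_def by (rule invertible_lang_map[OF assms(1)])
  ultimately show ?thesis
    using assms(1,2)
    by (simp add: fixed_GL_def frob_funpow_mult frob_funpow_matrix_inv matrix_inv_mult
        invertible_mult invertible_matrix_inv matrix_mul_assoc matrix_inv_cancel)
qed

lemma card_lang_fibre:
  fixes a :: "'a::{field,finite} alg_closure^'n^'n"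
  assumes e: "0 < e" and a: "invertible a" and b: "(frob ^^ e) a = a ** b"
  shows "finite {s :: 'a alg_closure^'n^'n. (frob ^^ e) s = s ** b}"
    and "card {s :: 'a alg_closure^'n^'n. (frob ^^ e) s = s ** b} = (CARD('a) ^ e) ^ (CARD('n) * CARD('n))"
proof -
  let ?C = "{c :: 'a alg_closure^'n^'n. (frob ^^ e) c = c}"
  let ?V = "{s :: 'a alg_closure^'n^'n. (frob ^^ e) s = s ** b}"
  have bi: "invertible b"
    using invertible_lang_map[OF a] lang_map_eq_iff[OF a] b by metis
  have bij: "bij_betw (\<lambda>c. c ** a) ?C ?V"
  proof (rule bij_betwI[where g="\<lambda>s. s ** matrix_inv a"])
    show "(\<lambda>s. s ** matrix_inv a) \<in> ?V \<rightarrow> ?C"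
      using a b bi
      by (auto simp: frob_funpow_mult frob_funpow_matrix_inv matrix_inv_mult matrix_mul_assoc matrix_inv_cancel)
  qed (use a b in \<open>auto simp: frob_funpow_mult matrix_mul_assoc matrix_inv_cancel\<close>)
  show "finite ?V"
    using bij_betw_finite[OF bij] card_fixed_matrices(1)[OF e] by blast
  show "card ?V = (CARD('a) ^ e) ^ (CARD('n) * CARD('n))"
    unfolding bij_betw_same_card[OF bij, symmetric] by (rule card_fixed_matrices(2)[OF e])
qed

text \<open>
  Let \<open>p\<close> be an equation of \<open>Z\<close>. Since \<open>Z\<close> is stable under the fixed matrices, \<open>b\<close> lies in the image exactly
  when all such \<open>p\<close> vanish on the whole fibre over \<open>b\<close>. The factor \<open>det s\<close> makes \<open>p s * det s\<close> vanish also
  at the solutions \<open>s\<close> that are not invertible; hence the condition is that all coefficients in its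
  reduction, which are polynomials in \<open>b\<close>, are zero.
\<close>
lemma closed_in_GL_lang_image:
  fixes Z :: "('a::{field,finite} alg_closure^'n^'n) set"
  assumes e: "0 < e" and Z: "closed_in_GL Z"
    and stable: "\<And>c z. c \<in> fixed_GL e \<Longrightarrow> z \<in> Z \<Longrightarrow> c ** z \<in> Z"
  shows "closed_in_GL (lang_map e ` Z)"
proof -
  let ?Q = "CARD('a) ^ e"
  let ?E = "reduced_exponents ?Q :: ('n \<times> 'n \<Rightarrow> nat) set"
  have "1 < CARD('a)"
    using card_mono[of UNIV "{0, 1 :: 'a}"] by simp
  then have Q: "1 < ?Q"
    using e by (metis one_less_power)
  have frob_iff: "(\<chi> i j. s $ i $ j ^ ?Q) = (frob ^^ e) s" for s :: "'a alg_closure^'n^'n"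
    by (simp add: vec_eq_iff frob_funpow_nth)
  obtain P where P: "P \<subseteq> polyfuns UNIV" "Z = {A. invertible A \<and> (\<forall>p\<in>P. p A = 0)}"
    using Z unfolding closed_in_GL_def by blast
  have "reducible_fun ?Q (\<lambda>s b. p s * det s)" if "p \<in> P" for p
    using P(1) that by (intro reducible_fun_polyfun Q polyfuns.mult polyfuns_det) auto
  then have "\<forall>p\<in>P. \<exists>g. (\<forall>\<epsilon>. g \<epsilon> \<in> polyfuns UNIV) \<and>
      (\<forall>s b. (frob ^^ e) s = s ** b \<longrightarrow> p s * det s = (\<Sum>\<epsilon>\<in>?E. g \<epsilon> b * monomial_fun \<epsilon> s))"
    unfolding reducible_fun_def frob_iff by blast
  from bchoice[OF this] obtain g where
    "\<forall>p\<in>P. (\<forall>\<epsilon>. g p \<epsilon> \<in> polyfuns UNIV) \<and>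
      (\<forall>s b. (frob ^^ e) s = s ** b \<longrightarrow> p s * det s = (\<Sum>\<epsilon>\<in>?E. g p \<epsilon> b * monomial_fun \<epsilon> s))"
    by blast
  then have g: "\<And>p \<epsilon>. p \<in> P \<Longrightarrow> g p \<epsilon> \<in> polyfuns UNIV"
    "\<And>p s b. p \<in> P \<Longrightarrow> (frob ^^ e) s = s ** b \<Longrightarrow>
      p s * det s = (\<Sum>\<epsilon>\<in>?E. g p \<epsilon> b * monomial_fun \<epsilon> s)"
    by blast+
  define R where "R = (\<lambda>(p, \<epsilon>). g p \<epsilon>) ` (P \<times> ?E)"
  have "R \<subseteq> polyfuns UNIV"
    using g(1) by (auto simp: R_def)
  moreover have "lang_map e ` Z = {b. invertible b \<and> (\<forall>r\<in>R. r b = 0)}"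
  proof (intro equalityI subsetI)
    fix b assume "b \<in> lang_map e ` Z"
    then obtain a where a: "a \<in> Z" "b = lang_map e a" by blast
    have ai: "invertible a"
      using a(1) P(2) by simp
    then have ab: "(frob ^^ e) a = a ** b"
      using a(2) lang_map_eq_iff by metis
    have "g p \<epsilon> b = 0" if p: "p \<in> P" and \<epsilon>: "\<epsilon> \<in> ?E" for p \<epsilon>
    proof (rule reduced_monomials_independent[OF Q _ _ _ _ \<epsilon>,
          where V="{s :: 'a alg_closure^'n^'n. (frob ^^ e) s = s ** b}" and \<gamma>="\<lambda>\<epsilon>. g p \<epsilon> b" and b=b])
      fix s :: "'a alg_closure^'n^'n"
      assume "s \<in> {s. (frob ^^ e) s = s ** b}"
      then have s: "(frob ^^ e) s = s ** b" by simp
      have "p s * det s = 0"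
      proof (cases "invertible s")
        case True
        then have "s ** matrix_inv a \<in> fixed_GL e"
          using lang_map_fibre[OF ai True] s ab by (metis lang_map_eq_iff ai True)
        then have "(s ** matrix_inv a) ** a \<in> Z"
          by (rule stable) (rule a(1))
        then show ?thesis
          using p P(2) by (simp add: matrix_inv_cancel ai)
      qed (simp add: invertible_det_nz)
      then show "(\<Sum>\<epsilon>\<in>?E. g p \<epsilon> b * monomial_fun \<epsilon> s) = 0"
        using g(2)[OF p s] by simp
    qed (use card_lang_fibre[OF e ai ab] in \<open>simp_all add: frob_iff\<close>)
    then show "b \<in> {b. invertible b \<and> (\<forall>r\<in>R. r b = 0)}"
      using a(2) invertible_lang_map[OF ai] by (auto simp: R_def)
  next
    fix b assume "b \<in> {b. invertible b \<and> (\<forall>r\<in>R. r b = 0)}"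
    then have b: "invertible b" "\<And>p \<epsilon>. p \<in> P \<Longrightarrow> \<epsilon> \<in> ?E \<Longrightarrow> g p \<epsilon> b = 0"
      by (auto simp: R_def)
    obtain a :: "'a alg_closure^'n^'n" where a: "invertible a" "(frob ^^ e) a = a ** b"
      using lang_GL[OF b(1) e] by blast
    have "p a = 0" if "p \<in> P" for p
    proof -
      have "p a * det a = 0"
        using g(2)[OF that a(2)] b(2)[OF that] by simp
      then show ?thesis
        using a(1) by (simp add: invertible_det_nz)
    qed
    then have "a \<in> Z"
      using a(1) by (simp add: P(2))
    moreover have "b = lang_map e a"
      using a by (metis lang_map_eq_iff)
    ultimately show "b \<in> lang_map e ` Z" by blast
  qed
  ultimately show ?thesis
    unfolding closed_in_GL_def by blast
qed

section \<open>Closed subgroups\<close>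

lemma group_GL: "group (GL :: ('k::field^'n^'n) monoid)"
  by (rule groupI)
    (auto simp: GL_def invertible_mult matrix_mul_assoc invertible_def[of "mat 1"]
      intro: invertible_matrix_inv matrix_inv_left)

lemma inv_GL: "invertible A \<Longrightarrow> inv\<^bsub>GL\<^esub> A = matrix_inv A"
  for A :: "'k::field^'n^'n"
  by (rule group.inv_equality[OF group_GL]) (simp_all add: GL_def matrix_inv_left invertible_matrix_inv)

lemma
  assumes "closed_subgroup K G"
  shows closed_subgroup_invertible: "a \<in> G \<Longrightarrow> invertible a"
    and closed_subgroup_mult: "a \<in> G \<Longrightarrow> b \<in> G \<Longrightarrow> a ** b \<in> G"
    and closed_subgroup_inv: "a \<in> G \<Longrightarrow> matrix_inv a \<in> G"
    and closed_subgroup_one: "mat 1 \<in> G"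
proof -
  have G: "subgroup G GL"
    using assms by (simp add: closed_subgroup_def)
  show inv: "a \<in> G \<Longrightarrow> invertible a" for a
    using subgroup.subset[OF G] by (auto simp: GL_def)
  show "a \<in> G \<Longrightarrow> b \<in> G \<Longrightarrow> a ** b \<in> G"
    using subgroup.m_closed[OF G, of a b] by (simp add: GL_def)
  show "a \<in> G \<Longrightarrow> matrix_inv a \<in> G"
    using subgroup.m_inv_closed[OF G, of a] inv by (simp add: inv_GL)
  show "mat 1 \<in> G"
    using subgroup.one_closed[OF G] by (simp add: GL_def)
qed

lemma polyfuns_mono: "p \<in> polyfuns K \<Longrightarrow> K \<subseteq> K' \<Longrightarrow> p \<in> polyfuns K'"
  by (induction rule: polyfuns.induct) (auto intro: polyfuns.intros)

lemma closed_subgroup_imp_closed_in_GL: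
  assumes "closed_subgroup K G"
  shows "closed_in_GL G"
proof -
  obtain P where P: "P \<subseteq> polyfuns K" "G = {A. invertible A \<and> (\<forall>p\<in>P. p A = 0)}"
    using assms unfolding closed_subgroup_def by blast
  have "P \<subseteq> polyfuns UNIV"
    using P(1) polyfuns_mono[OF _ subset_UNIV] by blast
  then show ?thesis
    unfolding closed_in_GL_def using P(2) by blast
qed

lemma polyfuns_frob:
  fixes A :: "'a::{field,finite} alg_closure^'n^'n"
  assumes "p \<in> polyfuns (range to_ac)"
  shows "p ((frob ^^ e) A) = p A ^ CARD('a) ^ e"
  using assms
  by (induction rule: polyfuns.induct)
    (auto simp: frobenius_to_ac frob_funpow_nth frobenius_add power_mult_distrib)

lemma closed_subgroup_frob:
  assumes "closed_subgroup (range to_ac) G" "a \<in> G"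
  shows "(frob ^^ e) a \<in> G"
proof -
  obtain P where P: "P \<subseteq> polyfuns (range to_ac)" "G = {A. invertible A \<and> (\<forall>p\<in>P. p A = 0)}"
    using assms(1) unfolding closed_subgroup_def by blast
  have "p ((frob ^^ e) a) = 0" if "p \<in> P" for p
    using polyfuns_frob[of p e a] P that assms(2) by (auto simp: zero_power)
  then show ?thesis
    using assms(2) P(2) by (simp add: invertible_frob_funpow)
qed

section \<open>Twisted orbits and Lang's theorem\<close>

definition twisted_orbit ::
    "nat \<Rightarrow> ('a::{field,finite} alg_closure^'n^'n) set \<Rightarrow> 'a alg_closure^'n^'n \<Rightarrow> ('a alg_closure^'n^'n) set" where
  "twisted_orbit e G x = (\<lambda>a. matrix_inv a ** x ** (frob ^^ e) a) ` G"

lemma twisted_orbit_subset: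
  assumes "closed_subgroup (range to_ac) G" "x \<in> G"
  shows "twisted_orbit e G x \<subseteq> G"
  using assms by (auto simp: twisted_orbit_def
      intro!: closed_subgroup_mult closed_subgroup_inv closed_subgroup_frob)

lemma twisted_orbit_self:
  fixes G :: "('a::{field,finite} alg_closure^'n^'n) set"
  assumes "closed_subgroup K G"
  shows "x \<in> twisted_orbit e G x"
proof -
  have "matrix_inv (mat 1) = (mat 1 :: 'a alg_closure^'n^'n)"
    by (rule matrix_inv_unique_left) (auto simp: invertible_def intro: exI[of _ "mat 1"])
  then show ?thesis
    unfolding twisted_orbit_def using closed_subgroup_one[OF assms]
    by (intro image_eqI[of _ _ "mat 1"]) simp_all
qed

lemma twisted_orbit_eq:
  fixes G :: "('a::{field,finite} alg_closure^'n^'n) set"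
  assumes G: "closed_subgroup (range to_ac) G" and z: "z \<in> twisted_orbit e G x"
  shows "twisted_orbit e G z = twisted_orbit e G x"
proof -
  obtain a where a: "a \<in> G" "z = matrix_inv a ** x ** (frob ^^ e) a"
    using z unfolding twisted_orbit_def by blast
  note inv = closed_subgroup_invertible[OF G]
  have "matrix_inv b ** z ** (frob ^^ e) b = matrix_inv (a ** b) ** x ** (frob ^^ e) (a ** b)"
    if "b \<in> G" for b
    using inv[OF a(1)] inv[OF that] a(2)
    by (simp add: matrix_inv_mult frob_funpow_mult matrix_mul_assoc)
  then have "twisted_orbit e G z = (\<lambda>b. matrix_inv b ** x ** (frob ^^ e) b) ` ((**) a ` G)"
    unfolding twisted_orbit_def image_image by (intro image_cong refl)
  also have "(**) a ` G = G"
  proof (intro equalityI subsetI)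
    fix b assume "b \<in> G"
    then have "matrix_inv a ** b \<in> G"
      using a(1) G by (simp add: closed_subgroup_mult closed_subgroup_inv)
    then show "b \<in> (**) a ` G"
      by (rule rev_image_eqI) (simp add: matrix_inv_cancel inv[OF a(1)])
  qed (use closed_subgroup_mult[OF G] a(1) in auto)
  finally show ?thesis
    unfolding twisted_orbit_def .
qed

text \<open>
  If \<open>x = L(c)\<close> for a matrix \<open>c\<close> in the general linear group, the orbit of \<open>x\<close> is \<open>L(c G)\<close>. To make the set
  stable under the finite group \<open>\<Gamma>\<close> of fixed matrices, replace \<open>c G\<close> by the finite union of closed
  sets \<open>\<Gamma> c G\<close>.
\<close>
lemma closed_in_GL_twisted_orbit:
  fixes G :: "('a::{field,finite} alg_closure^'n^'n) set"
  assumes e: "0 < e" and G: "closed_subgroup (range to_ac) G" and x: "x \<in> G"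
  shows "closed_in_GL (twisted_orbit e G x)"
proof -
  note inv = closed_subgroup_invertible[OF G]
  obtain c :: "'a alg_closure^'n^'n" where c: "invertible c" "(frob ^^ e) c = c ** x"
    using lang_GL[OF inv[OF x] e] by blast
  then have xc: "x = lang_map e c"
    by (metis lang_map_eq_iff)
  define Z where "Z = (\<Union>\<gamma>\<in>fixed_GL e. (**) (\<gamma> ** c) ` G)"
  have "closed_in_GL Z"
    unfolding Z_def
    using c(1) closed_subgroup_imp_closed_in_GL[OF G]
    by (intro closed_in_GL_UN finite_fixed_GL[OF e] closed_in_GL_translate)
      (auto simp: fixed_GL_def invertible_mult)
  moreover have "\<gamma> ** z \<in> Z" if "\<gamma> \<in> fixed_GL e" "z \<in> Z" for \<gamma> z
  proof -
    obtain \<delta> a where \<delta>: "\<delta> \<in> fixed_GL e" "a \<in> G" "z = (\<delta> ** c) ** a"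
      using \<open>z \<in> Z\<close> unfolding Z_def by blast
    have "\<gamma> ** \<delta> \<in> fixed_GL e"
      using that(1) \<delta>(1) by (simp add: fixed_GL_def invertible_mult frob_funpow_mult)
    moreover have "\<gamma> ** z = ((\<gamma> ** \<delta>) ** c) ** a"
      by (simp add: \<delta>(3) matrix_mul_assoc)
    ultimately show ?thesis
      unfolding Z_def using \<delta>(2) by blast
  qed
  ultimately have "closed_in_GL (lang_map e ` Z)"
    by (rule closed_in_GL_lang_image[OF e])
  moreover have "lang_map e ` Z = twisted_orbit e G x"
  proof -
    have *: "lang_map e ((\<gamma> ** c) ** a) = matrix_inv a ** x ** (frob ^^ e) a"
      if "\<gamma> \<in> fixed_GL e" "a \<in> G" for \<gamma> a
      using that c(1) inv[OF that(2)]
      by (simp add: xc lang_map_fixed_mult lang_map_mult invertible_mult fixed_GL_def)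
    have one: "mat 1 \<in> fixed_GL e"
      by (auto simp: fixed_GL_def invertible_def intro: exI[of _ "mat 1"])
    show ?thesis
      unfolding Z_def twisted_orbit_def image_UN image_image
      using one by (auto simp: *)
  qed
  ultimately show ?thesis by simp
qed

text \<open>
  Suppose that there are more orbits than elements of \<open>\<Gamma>\<close>, and let \<open>Gm\<close> be the finite group of points of \<open>G\<close>
  over a finite field that contains the entries of representatives \<open>x\<close> of \<open>|\<Gamma>| + 1\<close> of them. Writing
  \<open>x = L(c)\<close>, the map \<open>a \<mapsto> a\<inverse> x F(a) = L(c a)\<close> on \<open>Gm\<close> has fibres of size at most \<open>|\<Gamma>|\<close>, so every one of
  these orbits meets \<open>Gm\<close> in at least \<open>|Gm| / |\<Gamma>|\<close> points. As the orbits are disjoint, this is too much.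
\<close>
lemma finite_twisted_orbits:
  fixes G :: "('a::{field,finite} alg_closure^'n^'n) set"
  assumes e: "0 < e" and G: "closed_subgroup (range to_ac) G"
  shows "finite (twisted_orbit e G ` G)"
proof (rule ccontr)
  note inv = closed_subgroup_invertible[OF G]
  let ?\<Gamma> = "fixed_GL e :: ('a alg_closure^'n^'n) set"
  assume "infinite (twisted_orbit e G ` G)"
  then obtain S where S: "finite S" "card S = Suc (card ?\<Gamma>)" "S \<subseteq> twisted_orbit e G ` G"
    using infinite_arbitrarily_large by metis
  define r where "r = inv_into G (twisted_orbit e G)"
  have r: "r u \<in> G" "twisted_orbit e G (r u) = u" if "u \<in> S" for u
    using that S(3) by (auto simp: r_def inv_into_into f_inv_into_f subset_iff)
  let ?entries = "\<Union>u\<in>S. \<Union>i. range (($) (r u $ i))"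
  obtain m where m: "0 < m" "\<forall>x\<in>?entries. x ^ CARD('a) ^ m = x"
    using frobenius_common_period[of ?entries] S(1) by auto
  define Gm where "Gm = {g \<in> G. (frob ^^ m) g = g}"
  have fin: "finite Gm"
    by (rule finite_subset[OF _ card_fixed_matrices(1)[OF m(1)]]) (auto simp: Gm_def)
  have "mat 1 \<in> Gm"
    using closed_subgroup_one[OF G] by (simp add: Gm_def)
  then have pos: "0 < card Gm"
    using fin card_gt_0_iff by blast
  have rm: "r u \<in> Gm" if "u \<in> S" for u
  proof -
    have "(frob ^^ m) (r u) = r u"
      using m(2) that by (auto simp: vec_eq_iff frob_funpow_nth)
    then show ?thesis using r(1)[OF that] by (simp add: Gm_def)
  qed
  define f where "f u a = matrix_inv a ** r u ** (frob ^^ e) a" for u and a :: "'a alg_closure^'n^'n"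
  have f_mem: "f u ` Gm \<subseteq> u \<inter> Gm" if u: "u \<in> S" for u
  proof
    fix z assume "z \<in> f u ` Gm"
    then obtain a where a: "a \<in> Gm" "z = f u a" by blast
    have "(frob ^^ m) ((frob ^^ e) a) = (frob ^^ e) ((frob ^^ m) a)"
      by (metis add.commute comp_apply funpow_add)
    then have "(frob ^^ m) z = z"
      using a rm[OF u] inv[of a]
      by (simp add: Gm_def f_def frob_funpow_mult frob_funpow_matrix_inv)
    moreover have "z \<in> twisted_orbit e G (r u)"
      using a by (auto simp: f_def twisted_orbit_def Gm_def)
    ultimately show "z \<in> u \<inter> Gm"
      using r[OF u] twisted_orbit_subset[OF G r(1)[OF u]] by (auto simp: Gm_def)
  qed
  have fibre: "card {a \<in> Gm. f u a = z} \<le> card ?\<Gamma>" if u: "u \<in> S" for u z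
  proof (cases "{a \<in> Gm. f u a = z} = {}")
    case False
    then obtain a0 where a0: "a0 \<in> Gm" "f u a0 = z" by blast
    obtain c :: "'a alg_closure^'n^'n" where c: "invertible c" "(frob ^^ e) c = c ** r u"
      using lang_GL[OF inv[OF r(1)[OF u]] e] by blast
    then have rc: "r u = lang_map e c"
      by (metis lang_map_eq_iff)
    have f_lang: "f u a = lang_map e (c ** a)" if "a \<in> Gm" for a
      using that inv[of a] c(1) by (simp add: f_def rc lang_map_mult Gm_def)
    let ?h = "\<lambda>a. (c ** a) ** matrix_inv (c ** a0)"
    have ca0: "invertible (c ** a0)"
      using c(1) a0(1) inv by (simp add: invertible_mult Gm_def)
    have h_sub: "?h ` {a \<in> Gm. f u a = z} \<subseteq> ?\<Gamma>"
      using a0 f_lang inv c(1) ca0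
      by (auto simp: Gm_def invertible_mult intro!: lang_map_fibre)
    have h_inj: "inj_on ?h {a \<in> Gm. f u a = z}"
      by (rule inj_on_inverseI[where g="\<lambda>\<gamma>. matrix_inv c ** (\<gamma> ** (c ** a0))"])
        (simp add: matrix_inv_cancel ca0 c(1))
    show ?thesis
      by (rule card_inj_on_le[OF h_inj h_sub finite_fixed_GL[OF e]])
  next
    case True
    then show ?thesis by (simp only: card.empty)
  qed
  have bound: "card Gm \<le> card ?\<Gamma> * card (f u ` Gm)" if "u \<in> S" for u
  proof -
    have "card Gm = (\<Sum>z\<in>f u ` Gm. card {a \<in> Gm. f u a = z})"
      using sum.image_gen[OF fin, of "\<lambda>_. 1 :: nat" "f u"] by simp
    also have "\<dots> \<le> (\<Sum>z\<in>f u ` Gm. card ?\<Gamma>)"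
      by (intro sum_mono fibre[OF that])
    finally show ?thesis by (simp add: mult.commute)
  qed
  have disjoint: "f u ` Gm \<inter> f u' ` Gm = {}" if "u \<in> S" "u' \<in> S" "u \<noteq> u'" for u u'
  proof -
    have "u \<inter> u' = {}"
      using that r(2) twisted_orbit_eq[OF G] by (metis disjoint_iff)
    then show ?thesis
      using f_mem that by blast
  qed
  have "card S * card Gm \<le> (\<Sum>u\<in>S. card ?\<Gamma> * card (f u ` Gm))"
    using sum_mono[of S "\<lambda>_. card Gm", OF bound] by simp
  also have "\<dots> = card ?\<Gamma> * card (\<Union>u\<in>S. f u ` Gm)"
    using disjoint S(1) fin
    by (subst card_UN_disjoint) (simp_all add: sum_distrib_left)
  also have "\<dots> \<le> card ?\<Gamma> * card Gm"
    using f_mem fin by (intro mult_le_mono2 card_mono) auto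
  finally show False
    using pos S(2) by simp
qed

lemma closed_in_GL_imp_closedin_zariski:
  fixes Z :: "('k::field^'n^'n) set"
  assumes "closed_in_GL Z"
  shows "\<exists>E. closedin zariski E \<and> Z = {A. invertible A} \<inter> E"
proof -
  obtain P where P: "P \<subseteq> polyfuns UNIV" "Z = {A. invertible A \<and> (\<forall>p\<in>P. p A = 0)}"
    using assms unfolding closed_in_GL_def by (elim exE conjE)
  have "openin zariski (UNIV :: ('k^'n^'n) set)"
    unfolding openin_zariski
    by (rule exI[of _ "{\<lambda>_. 1}"]) (auto intro: polyfuns.const)
  then have top: "topspace (zariski :: ('k^'n^'n) topology) = UNIV"
    using openin_subset by blast
  have "UNIV - {A. \<forall>p\<in>P. p A = 0} = {A. \<exists>p\<in>P. p A \<noteq> 0}" by auto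
  then have "closedin zariski {A. \<forall>p\<in>P. p A = 0}"
    unfolding closedin_def top using P(1) by (auto simp: openin_zariski)
  then show ?thesis
    unfolding P(2) by blast
qed

text \<open>
  The orbit of the identity matrix is the image of \<open>a \<mapsto> a\<inverse> F(a)\<close>. It and the union of the other
  orbits are disjoint closed sets that cover the connected group \<open>G\<close>.
\<close>
theorem lang:
  fixes G :: "('a::{field,finite} alg_closure^'n^'n) set"
  assumes e: "0 < e" and G: "closed_subgroup (range to_ac) G" and conn: "connectedin zariski G"
    and y: "y \<in> G"
  shows "\<exists>a\<in>G. matrix_inv a ** (frob ^^ e) a = y"
proof (rule ccontr)
  assume no: "\<not> (\<exists>a\<in>G. matrix_inv a ** (frob ^^ e) a = y)"
  let ?O1 = "twisted_orbit e G (mat 1)"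
  define R where "R = \<Union> (twisted_orbit e G ` G - {?O1})"
  have y_notin: "y \<notin> ?O1"
    using no by (auto simp: twisted_orbit_def image_iff)
  have one: "mat 1 \<in> G"
    by (rule closed_subgroup_one[OF G])
  have cover: "G = ?O1 \<union> R"
  proof (intro equalityI subsetI)
    fix x assume "x \<in> G"
    then show "x \<in> ?O1 \<union> R"
      using twisted_orbit_self[OF G, of x e] unfolding R_def
      by (cases "twisted_orbit e G x = ?O1") blast+
  next
    fix x assume "x \<in> ?O1 \<union> R"
    then show "x \<in> G"
      using twisted_orbit_subset[OF G] one unfolding R_def by blast
  qed
  have disjoint: "?O1 \<inter> R = {}"
  proof (rule ccontr)
    assume "?O1 \<inter> R \<noteq> {}"
    then obtain x z where "x \<in> ?O1" "x \<in> twisted_orbit e G z" "twisted_orbit e G z \<noteq> ?O1"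
      unfolding R_def by blast
    then show False
      using twisted_orbit_eq[OF G, of x] by blast
  qed
  have "closed_in_GL ?O1"
    by (rule closed_in_GL_twisted_orbit[OF e G one])
  then obtain E1 where E1: "closedin zariski E1" "?O1 = {A. invertible A} \<inter> E1"
    using closed_in_GL_imp_closedin_zariski by blast
  have "closed_in_GL R"
    unfolding R_def using finite_twisted_orbits[OF e G] closed_in_GL_twisted_orbit[OF e G]
    by (intro closed_in_GL_UN[where Z="\<lambda>x. x", simplified]) auto
  then obtain E2 where E2: "closedin zariski E2" "R = {A. invertible A} \<inter> E2"
    using closed_in_GL_imp_closedin_zariski by blast
  have "G \<subseteq> {A. invertible A}"
    using closed_subgroup_invertible[OF G] by blast
  then have sub: "G \<subseteq> E1 \<union> E2" "E1 \<inter> E2 \<inter> G = {}" and O1: "E1 \<inter> G = ?O1" and R: "E2 \<inter> G = R"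
    using E1(2) E2(2) cover disjoint by blast+
  have "E1 \<inter> G \<noteq> {}"
    unfolding O1 using twisted_orbit_self[OF G] by blast
  moreover have "E2 \<inter> G \<noteq> {}"
    unfolding R using y y_notin cover by blast
  ultimately have "\<exists>E1 E2. closedin zariski E1 \<and> closedin zariski E2 \<and>
      G \<subseteq> E1 \<union> E2 \<and> E1 \<inter> E2 \<inter> G = {} \<and> E1 \<inter> G \<noteq> {} \<and> E2 \<inter> G \<noteq> {}"
    using E1(1) E2(1) sub by (intro exI conjI)
  then show False
    using conn by (simp only: connectedin_closedin simp_thms)
qed

section \<open>Characters of finite groups\<close>

lemma vector_space_matrix: "vector_space (\<lambda>(c::'k::field) (A::'k^'d^'e). \<chi> i j. c * A $ i $ j)"
  by unfold_locales (simp_all add: vec_eq_iff algebra_simps)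

lemma matrix_add_rdistrib: "(A + B) ** C = A ** C + B ** C"
  for C :: "'k::semiring_1^'n^'m"
  by (simp add: vec_eq_iff matrix_matrix_mult_def distrib_right sum.distrib)

lemma matrix_sum_mult_left: "M ** (\<Sum>x\<in>I. f x) = (\<Sum>x\<in>I. M ** f x)"
  for M :: "'k::ring_1^'n^'m"
  by (induction I rule: infinite_finite_induct) (simp_all add: matrix_add_ldistrib)

lemma matrix_sum_mult_right: "(\<Sum>x\<in>I. f x) ** M = (\<Sum>x\<in>I. f x ** M)"
  for M :: "'k::ring_1^'n^'m"
  by (induction I rule: infinite_finite_induct) (simp_all add: matrix_add_rdistrib)

lemma matrix_sum_vector_mult: "(\<Sum>x\<in>I. f x) *v v = (\<Sum>x\<in>I. f x *v v)"
  for v :: "'k::ring_1^'n"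
  by (induction I rule: infinite_finite_induct) (simp_all add: matrix_vector_mult_add_rdistrib)

text \<open>
  In terms of a basis \<open>B\<close> of \<open>W\<close> with coordinate functionals \<open>\<phi>\<close> on the whole space, \<open>P A = \<Sum>b\<in>B. \<phi> b A \<cdot> b\<close>, and
  so the trace of \<open>P\<close> is \<open>\<Sum>b\<in>B. \<phi> b b = card B\<close>.
\<close>
lemma trace_projection_eq_dim:
  fixes P :: "'k::field^'d^'e \<Rightarrow> 'k^'d^'e"
  assumes add: "\<And>A B. P (A + B) = P A + P B"
    and scale: "\<And>c A. P (\<chi> i j. c * A $ i $ j) = (\<chi> i j. c * P A $ i $ j)"
    and W: "\<And>A. P A \<in> W" and id: "\<And>A. A \<in> W \<Longrightarrow> P A = A"
  shows "(\<Sum>i\<in>UNIV. \<Sum>j\<in>UNIV. P (axis i (axis j 1)) $ i $ j) =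
    of_nat (vector_space.dim (\<lambda>c A. \<chi> i j. c * A $ i $ j) W)"
proof -
  let ?s = "\<lambda>(c::'k) (A::'k^'d^'e). \<chi> i j. c * A $ i $ j"
  interpret mv: vector_space ?s by (rule vector_space_matrix)
  define u :: "'e \<Rightarrow> 'd \<Rightarrow> 'k^'d^'e" where "u i j = axis i (axis j 1)" for i j
  have if_sum: "(\<Sum>j\<in>UNIV. if b then f j else 0) = (if b then sum f UNIV else 0)"
    for b and f :: "'d \<Rightarrow> 'k"
    by simp
  have expand: "A = (\<Sum>i\<in>UNIV. \<Sum>j\<in>UNIV. ?s (A $ i $ j) (u i j))" for A
    by (simp add: vec_eq_iff u_def axis_def if_sum if_distrib[of "\<lambda>x. x $ _"]
        if_distrib[of "\<lambda>x. _ * x"] cong: if_cong)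
  obtain B where B: "B \<subseteq> W" "mv.independent B" "W \<subseteq> mv.span B" "card B = mv.dim W"
    using mv.basis_exists[of W] by metis
  have "A \<in> mv.span (\<Union>i. range (u i))" for A
    by (subst expand) (intro mv.span_sum mv.span_scale mv.span_base, blast)
  then have fin: "finite B"
    using mv.independent_span_bound[OF _ B(2), of "\<Union>i. range (u i)"] by auto
  define \<phi> where "\<phi> b A = mv.representation B (P A) b" for b A
  have lin: "Vector_Spaces.linear ?s (*) (\<phi> b)" for b
    unfolding Vector_Spaces.linear_iff
  proof (intro conjI allI)
    have PB: "P A \<in> mv.span B" for A
      using W B(3) by blast
    show "\<phi> b (A + C) = \<phi> b A + \<phi> b C" for A C
      using mv.representation_add[OF B(2) PB PB] by (simp add: \<phi>_def add)
    show "\<phi> b (?s c A) = c * \<phi> b A" for c A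
      using mv.representation_scale[OF B(2) PB] by (simp add: \<phi>_def scale)
  qed (rule vector_space_matrix, rule vector_space_over_itself.vector_space_axioms)
  have "(\<Sum>i\<in>UNIV. \<Sum>j\<in>UNIV. P (u i j) $ i $ j) =
      (\<Sum>i\<in>UNIV. \<Sum>j\<in>UNIV. \<Sum>b\<in>B. b $ i $ j * \<phi> b (u i j))"
  proof (intro sum.cong refl)
    fix i j
    have "P (u i j) = (\<Sum>b\<in>B. ?s (\<phi> b (u i j)) b)"
      unfolding \<phi>_def
      by (rule mv.sum_representation_eq[OF B(2) _ fin order.refl, symmetric]) (use W B(3) in blast)
    then have "P (u i j) $ i $ j = (\<Sum>b\<in>B. ?s (\<phi> b (u i j)) b) $ i $ j"
      by simp
    then show "P (u i j) $ i $ j = (\<Sum>b\<in>B. b $ i $ j * \<phi> b (u i j))"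
      by (simp add: mult.commute)
  qed
  also have "\<dots> = (\<Sum>b\<in>B. \<Sum>i\<in>UNIV. \<Sum>j\<in>UNIV. b $ i $ j * \<phi> b (u i j))"
    by (simp only: sum.swap[of _ B])
  also have "\<dots> = (\<Sum>b\<in>B. \<phi> b b)"
  proof (intro sum.cong refl)
    fix b
    interpret L: Vector_Spaces.linear ?s "(*)" "\<phi> b" by (rule lin)
    show "(\<Sum>i\<in>UNIV. \<Sum>j\<in>UNIV. b $ i $ j * \<phi> b (u i j)) = \<phi> b b"
      by (subst (4) expand) (simp only: L.sum L.scale)
  qed
  also have "\<dots> = (\<Sum>b\<in>B. 1)"
    using B(1,2) by (intro sum.cong refl) (auto simp: \<phi>_def id mv.representation_basis)
  finally show ?thesis
    by (simp add: u_def B(4))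
qed

lemma representation_mult:
  assumes "representation K \<rho>" "g \<in> carrier K" "h \<in> carrier K"
  shows "\<rho> (g \<otimes>\<^bsub>K\<^esub> h) = \<rho> g ** \<rho> h"
  using assms by (simp add: representation_def hom_def GL_def)

lemma representation_one:
  assumes "group K" "representation K \<rho>"
  shows "\<rho> \<one>\<^bsub>K\<^esub> = mat 1"
proof -
  interpret K: group K by fact
  have "invertible (\<rho> \<one>\<^bsub>K\<^esub>)"
    using assms(2) by (auto simp: representation_def hom_def GL_def)
  then obtain B where "\<rho> \<one>\<^bsub>K\<^esub> ** B = mat 1"
    unfolding invertible_def by blast
  moreover have "\<rho> \<one>\<^bsub>K\<^esub> ** \<rho> \<one>\<^bsub>K\<^esub> = \<rho> \<one>\<^bsub>K\<^esub>"
    using representation_mult[OF assms(2) K.one_closed K.one_closed] by simp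
  ultimately show ?thesis
    by (metis matrix_mul_assoc matrix_mul_rid)
qed

lemma representation_inv:
  assumes "group K" "representation K \<rho>" "g \<in> carrier K"
  shows "\<rho> g ** \<rho> (inv\<^bsub>K\<^esub> g) = mat 1" "\<rho> (inv\<^bsub>K\<^esub> g) ** \<rho> g = mat 1"
proof -
  interpret K: group K by fact
  show "\<rho> g ** \<rho> (inv\<^bsub>K\<^esub> g) = mat 1" "\<rho> (inv\<^bsub>K\<^esub> g) ** \<rho> g = mat 1"
    using assms(3) representation_one[OF assms(1,2)]
    by (simp_all flip: representation_mult[OF assms(2)])
qed

lemma group_sum_translate:
  assumes "group K" "h \<in> carrier K"
  shows "(\<Sum>g\<in>carrier K. f (h \<otimes>\<^bsub>K\<^esub> g)) = (\<Sum>g\<in>carrier K. f g)"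
    and "(\<Sum>g\<in>carrier K. f (g \<otimes>\<^bsub>K\<^esub> h)) = (\<Sum>g\<in>carrier K. f g)"
proof -
  interpret K: group K by fact
  have "bij_betw (\<lambda>g. h \<otimes>\<^bsub>K\<^esub> g) (carrier K) (carrier K)"
    using assms(2) by (intro bij_betwI[where g="\<lambda>g. inv\<^bsub>K\<^esub> h \<otimes>\<^bsub>K\<^esub> g"]) (auto simp flip: K.m_assoc)
  then show "(\<Sum>g\<in>carrier K. f (h \<otimes>\<^bsub>K\<^esub> g)) = (\<Sum>g\<in>carrier K. f g)"
    by (rule sum.reindex_bij_betw)
  have "bij_betw (\<lambda>g. g \<otimes>\<^bsub>K\<^esub> h) (carrier K) (carrier K)"
    using assms(2) by (intro bij_betwI[where g="\<lambda>g. g \<otimes>\<^bsub>K\<^esub> inv\<^bsub>K\<^esub> h"]) (auto simp: K.m_assoc)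
  then show "(\<Sum>g\<in>carrier K. f (g \<otimes>\<^bsub>K\<^esub> h)) = (\<Sum>g\<in>carrier K. f g)"
    by (rule sum.reindex_bij_betw)
qed

text \<open>
  The average of \<open>A \<mapsto> \<rho>' g ** A ** \<rho> (inv g)\<close> over the group is a projection onto the space of
  intertwiners, and the trace of a single term of the average is the product of two traces.
\<close>
lemma hom_dim_eq_character_sum:
  fixes \<rho> :: "'g \<Rightarrow> complex^'d^'d" and \<rho>' :: "'g \<Rightarrow> complex^'e^'e"
  assumes K: "group K" and fin: "finite (carrier K)"
    and \<rho>: "representation K \<rho>" and \<rho>': "representation K \<rho>'"
  shows "of_nat (card (carrier K)) * of_nat (hom_dim K \<rho> \<rho>') =
    (\<Sum>g\<in>carrier K. trace (\<rho>' g) * trace (\<rho> (inv\<^bsub>K\<^esub> g)))"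
proof -
  interpret K: group K by (rule K)
  let ?N = "of_nat (card (carrier K)) :: complex"
  have N: "?N \<noteq> 0"
    using fin K.one_closed by (auto simp: card_eq_0_iff)
  define T where "T A = (\<Sum>g\<in>carrier K. \<rho>' g ** A ** \<rho> (inv\<^bsub>K\<^esub> g))" for A :: "complex^'d^'e"
  define P where "P A = (\<chi> i j. inverse ?N * T A $ i $ j)" for A
  have T_add: "T (A + B) = T A + T B" for A B
    by (simp add: T_def matrix_add_ldistrib matrix_add_rdistrib sum.distrib)
  have T_scale: "T (\<chi> i j. c * A $ i $ j) = (\<chi> i j. c * T A $ i $ j)" for c A
    by (simp add: T_def vec_eq_iff matrix_matrix_mult_def sum_distrib_left sum_distrib_right mult_ac)
  have T_hom: "T A ** \<rho> h = \<rho>' h ** T A" if h: "h \<in> carrier K" for A h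
  proof -
    have "T A ** \<rho> h = (\<Sum>g\<in>carrier K. \<rho>' (h \<otimes>\<^bsub>K\<^esub> g) ** A ** \<rho> (inv\<^bsub>K\<^esub> (h \<otimes>\<^bsub>K\<^esub> g))) ** \<rho> h"
      unfolding T_def group_sum_translate(1)[OF K h, of "\<lambda>g. \<rho>' g ** A ** \<rho> (inv\<^bsub>K\<^esub> g)"] ..
    also have "\<dots> = (\<Sum>g\<in>carrier K. \<rho>' h ** (\<rho>' g ** A ** \<rho> (inv\<^bsub>K\<^esub> g)))"
      unfolding matrix_sum_mult_right
    proof (intro sum.cong refl)
      fix g assume g: "g \<in> carrier K"
      have "\<rho>' (h \<otimes>\<^bsub>K\<^esub> g) ** A ** \<rho> (inv\<^bsub>K\<^esub> (h \<otimes>\<^bsub>K\<^esub> g)) ** \<rho> h =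
          \<rho>' h ** \<rho>' g ** A ** (\<rho> (inv\<^bsub>K\<^esub> g) ** (\<rho> (inv\<^bsub>K\<^esub> h) ** \<rho> h))"
        using g h by (simp add: representation_mult[OF \<rho>] representation_mult[OF \<rho>'] K.inv_mult_group matrix_mul_assoc)
      then show "\<rho>' (h \<otimes>\<^bsub>K\<^esub> g) ** A ** \<rho> (inv\<^bsub>K\<^esub> (h \<otimes>\<^bsub>K\<^esub> g)) ** \<rho> h =
          \<rho>' h ** (\<rho>' g ** A ** \<rho> (inv\<^bsub>K\<^esub> g))"
        using representation_inv(2)[OF K \<rho> h] by (simp add: matrix_mul_assoc)
    qed
    finally show ?thesis
      by (simp add: T_def matrix_sum_mult_left)
  qed
  have scale_right: "(\<chi> i j. c * A $ i $ j) ** M = (\<chi> i j. c * (A ** M) $ i $ j)"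
    and scale_left: "L ** (\<chi> i j. c * A $ i $ j) = (\<chi> i j. c * (L ** A) $ i $ j)"
    for c :: complex and A :: "complex^'d^'e" and M :: "complex^'d^'d" and L :: "complex^'e^'e"
    by (simp_all add: vec_eq_iff matrix_matrix_mult_def sum_distrib_left mult_ac)
  have PW: "P A \<in> Hom_rep K \<rho> \<rho>'" for A
    unfolding Hom_rep_def P_def by (simp add: scale_right scale_left T_hom)
  have P_id: "P A = A" if A: "A \<in> Hom_rep K \<rho> \<rho>'" for A
  proof -
    have "\<rho>' g ** A ** \<rho> (inv\<^bsub>K\<^esub> g) = A" if g: "g \<in> carrier K" for g
    proof -
      have "\<rho>' g ** A ** \<rho> (inv\<^bsub>K\<^esub> g) = A ** (\<rho> g ** \<rho> (inv\<^bsub>K\<^esub> g))"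
        using A g by (simp add: Hom_rep_def matrix_mul_assoc)
      then show ?thesis
        using representation_inv(1)[OF K \<rho> g] by simp
    qed
    then have "T A = (\<Sum>g\<in>carrier K. A)"
      by (simp add: T_def)
    then have "T A $ i $ j = (\<Sum>g\<in>carrier K. A $ i $ j)" for i j
      by (simp only: sum_component)
    then show ?thesis
      using N by (simp add: P_def vec_eq_iff)
  qed
  have entry: "(M ** axis i (axis j 1) ** L) $ i $ j = M $ i $ i * L $ j $ j"
    for M :: "complex^'e^'e" and L :: "complex^'d^'d" and i j
    by (simp add: matrix_matrix_mult_def axis_def if_distrib[of "\<lambda>x. x $ _"] if_distrib[of "\<lambda>x. _ * x"]
        if_distrib[of "\<lambda>x. x * _"] cong: if_cong)
  have "of_nat (hom_dim K \<rho> \<rho>') = (\<Sum>i\<in>UNIV. \<Sum>j\<in>UNIV. P (axis i (axis j 1)) $ i $ j)"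
    unfolding hom_dim_def
    by (rule trace_projection_eq_dim[symmetric])
      (simp_all add: PW P_id, simp_all add: P_def T_add T_scale vec_eq_iff algebra_simps)
  also have "\<dots> = (\<Sum>i\<in>UNIV. \<Sum>j\<in>UNIV. inverse ?N *
      (\<Sum>g\<in>carrier K. \<rho>' g $ i $ i * \<rho> (inv\<^bsub>K\<^esub> g) $ j $ j))"
    by (simp add: P_def T_def entry)
  also have "\<dots> = inverse ?N * (\<Sum>g\<in>carrier K. trace (\<rho>' g) * trace (\<rho> (inv\<^bsub>K\<^esub> g)))"
    unfolding trace_def sum_product sum_distrib_left[symmetric] sum.swap[of _ "carrier K"] ..
  finally show ?thesis
    using N by (simp add: field_simps)
qed

definition adjoint_matrix :: "complex^'n^'m \<Rightarrow> complex^'m^'n" where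
  "adjoint_matrix A = (\<chi> i j. cnj (A $ j $ i))"

lemma adjoint_matrix_mult: "adjoint_matrix (A ** B) = adjoint_matrix B ** adjoint_matrix A"
  by (simp add: adjoint_matrix_def vec_eq_iff matrix_matrix_mult_def mult.commute)

lemma trace_adjoint_matrix: "trace (adjoint_matrix A) = cnj (trace A)"
  by (simp add: adjoint_matrix_def trace_def)

text \<open>
  Unitary trick: \<open>S = \<Sum>h. \<rho>(h)\<^sup>\<dagger> \<rho>(h)\<close> is positive definite, hence invertible, and
  \<open>\<rho>(g)\<^sup>\<dagger> S = S \<rho>(g\<inverse>)\<close>. So \<open>\<rho>(g)\<^sup>\<dagger>\<close> and \<open>\<rho>(g\<inverse>)\<close> are conjugate.
\<close>
lemma trace_representation_inv:
  fixes \<rho> :: "'g \<Rightarrow> complex^'d^'d"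
  assumes K: "group K" and fin: "finite (carrier K)" and \<rho>: "representation K \<rho>" and g: "g \<in> carrier K"
  shows "trace (\<rho> (inv\<^bsub>K\<^esub> g)) = cnj (trace (\<rho> g))"
proof -
  interpret K: group K by (rule K)
  define S where "S = (\<Sum>h\<in>carrier K. adjoint_matrix (\<rho> h) ** \<rho> h)"
  have quad: "(\<Sum>i\<in>UNIV. cnj (v $ i) * ((adjoint_matrix M ** M) *v v) $ i) =
      of_real (\<Sum>k\<in>UNIV. (cmod ((M *v v) $ k))\<^sup>2)" for M :: "complex^'d^'d" and v
  proof -
    have adj_nth: "(adjoint_matrix M *v w) $ i = (\<Sum>k\<in>UNIV. cnj (M $ k $ i) * w $ k)" for w i
      by (simp add: adjoint_matrix_def matrix_vector_mult_def)
    have cnj_nth: "cnj ((M *v v) $ k) = (\<Sum>i\<in>UNIV. cnj (M $ k $ i) * cnj (v $ i))" for k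
      by (simp add: matrix_vector_mult_def)
    have "(\<Sum>i\<in>UNIV. cnj (v $ i) * ((adjoint_matrix M ** M) *v v) $ i) =
        (\<Sum>i\<in>UNIV. cnj (v $ i) * (adjoint_matrix M *v (M *v v)) $ i)"
      by (simp only: matrix_vector_mul_assoc)
    also have "\<dots> = (\<Sum>i\<in>UNIV. \<Sum>k\<in>UNIV. cnj (v $ i) * (cnj (M $ k $ i) * (M *v v) $ k))"
      by (simp add: adj_nth sum_distrib_left)
    also have "\<dots> = (\<Sum>k\<in>UNIV. \<Sum>i\<in>UNIV. cnj (v $ i) * (cnj (M $ k $ i) * (M *v v) $ k))"
      by (rule sum.swap)
    also have "\<dots> = (\<Sum>k\<in>UNIV. cnj ((M *v v) $ k) * (M *v v) $ k)"
      by (simp add: cnj_nth sum_distrib_left sum_distrib_right mult_ac)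
    also have "\<dots> = of_real (\<Sum>k\<in>UNIV. (cmod ((M *v v) $ k))\<^sup>2)"
      unfolding of_real_sum by (intro sum.cong refl) (metis complex_norm_square mult.commute)
    finally show ?thesis .
  qed
  have S_ker: "v = 0" if "S *v v = 0" for v
  proof -
    have Sv: "(S *v v) $ i = (\<Sum>h\<in>carrier K. ((adjoint_matrix (\<rho> h) ** \<rho> h) *v v) $ i)" for i
      by (simp add: S_def matrix_sum_vector_mult)
    have "0 = (\<Sum>i\<in>UNIV. cnj (v $ i) * (S *v v) $ i)"
      using that by simp
    also have "\<dots> = (\<Sum>h\<in>carrier K. \<Sum>i\<in>UNIV. cnj (v $ i) * ((adjoint_matrix (\<rho> h) ** \<rho> h) *v v) $ i)"
      unfolding Sv sum_distrib_left by (rule sum.swap)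
    also have "\<dots> = of_real (\<Sum>h\<in>carrier K. \<Sum>k\<in>UNIV. (cmod ((\<rho> h *v v) $ k))\<^sup>2)"
      by (simp only: quad of_real_sum)
    finally have "(\<Sum>h\<in>carrier K. \<Sum>k\<in>UNIV. (cmod ((\<rho> h *v v) $ k))\<^sup>2) = 0"
      by (simp only: of_real_eq_0_iff eq_commute[of "0 :: complex"])
    then have "(\<Sum>k\<in>UNIV. (cmod ((\<rho> \<one>\<^bsub>K\<^esub> *v v) $ k))\<^sup>2) = 0"
      using fin by (subst (asm) sum_nonneg_eq_0_iff) (auto intro: sum_nonneg)
    then show "v = 0"
      by (simp add: representation_one[OF K \<rho>] sum_nonneg_eq_0_iff vec_eq_iff)
  qed
  then obtain R where R: "R ** S = mat 1" "S ** R = mat 1"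
    using matrix_left_invertible_ker[of S] matrix_left_right_inverse[of _ S] by blast
  have "adjoint_matrix (\<rho> g) ** S ** \<rho> g =
      (\<Sum>h\<in>carrier K. adjoint_matrix (\<rho> (h \<otimes>\<^bsub>K\<^esub> g)) ** \<rho> (h \<otimes>\<^bsub>K\<^esub> g))"
    unfolding S_def matrix_sum_mult_left matrix_sum_mult_right using g
    by (intro sum.cong refl)
      (simp add: representation_mult[OF \<rho>] adjoint_matrix_mult matrix_mul_assoc)
  also have "\<dots> = S"
    unfolding S_def by (rule group_sum_translate(2)[OF K g])
  finally have "adjoint_matrix (\<rho> g) ** S = S ** \<rho> (inv\<^bsub>K\<^esub> g)"
    using representation_inv(1)[OF K \<rho> g] by (metis matrix_mul_assoc matrix_mul_rid)
  then have "adjoint_matrix (\<rho> g) = S ** (\<rho> (inv\<^bsub>K\<^esub> g) ** R)"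
    using R(2) by (metis matrix_mul_assoc matrix_mul_rid)
  then have "trace (adjoint_matrix (\<rho> g)) = trace (S ** (\<rho> (inv\<^bsub>K\<^esub> g) ** R))"
    by simp
  also have "\<dots> = trace ((\<rho> (inv\<^bsub>K\<^esub> g) ** R) ** S)"
    by (rule trace_mul_sym)
  also have "\<dots> = trace (\<rho> (inv\<^bsub>K\<^esub> g))"
    using R(1) by (simp flip: matrix_mul_assoc)
  finally show ?thesis
    by (simp add: trace_adjoint_matrix)
qed

lemma hom_dim_eq_character_product:
  fixes \<rho> :: "'g \<Rightarrow> complex^'d^'d" and \<rho>' :: "'g \<Rightarrow> complex^'e^'e"
  assumes "group K" "finite (carrier K)" "representation K \<rho>" "representation K \<rho>'"
  shows "of_nat (card (carrier K)) * of_nat (hom_dim K \<rho> \<rho>') =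
    (\<Sum>g\<in>carrier K. trace (\<rho>' g) * cnj (trace (\<rho> g)))"
  unfolding hom_dim_eq_character_sum[OF assms]
  by (intro sum.cong refl) (simp add: trace_representation_inv[OF assms(1-3)])

section \<open>Rational points\<close>

lemma rational_points_simps [simp]:
  "g \<in> carrier (rational_points m G) \<longleftrightarrow> g \<in> G \<and> (frob ^^ m) g = g"
  "monoid.mult (rational_points m G) = (**)"
  by (simp_all add: rational_points_def GL_def)

lemma group_rational_points:
  fixes G :: "('a::{field,finite} alg_closure^'n^'n) set"
  assumes G: "closed_subgroup (range to_ac) G"
  shows "group (rational_points m G)"
proof -
  note inv = closed_subgroup_invertible[OF G]
  have GL: "a \<in> carrier GL \<longleftrightarrow> invertible a" "a \<otimes>\<^bsub>GL\<^esub> b = a ** b"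
    for a b :: "'a alg_closure^'n^'n"
    by (simp_all add: GL_def)
  have "subgroup {g \<in> G. (frob ^^ m) g = g} GL"
    by (rule group.subgroupI[OF group_GL])
      (use closed_subgroup_one[OF G] in \<open>auto simp: GL inv inv_GL closed_subgroup_inv[OF G]
        closed_subgroup_mult[OF G] frob_funpow_matrix_inv frob_funpow_mult\<close>)
  then show ?thesis
    unfolding rational_points_def by (rule group.subgroup_imp_group[OF group_GL])
qed

lemma finite_rational_points: "0 < m \<Longrightarrow> finite (carrier (rational_points m G))"
  by (rule finite_subset[OF _ card_fixed_matrices(1)]) auto

lemma representation_subset:
  assumes "representation K \<rho>" "carrier L \<subseteq> carrier K" "monoid.mult L = monoid.mult K"
  shows "representation L \<rho>"
  using assms unfolding representation_def hom_def by (auto simp: subset_iff)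

lemma E_points_sigma_simps:
  "x \<in> carrier (E_points_sigma G) \<longleftrightarrow> fst x \<in> carrier (G(\<bbbE>)) \<and> snd x \<in> {0, 1}"
  "(g, i) \<otimes>\<^bsub>E_points_sigma G\<^esub> (h, j) = (g ** (frob ^^ nat i) h, (i + j) mod 2)"
  "\<one>\<^bsub>E_points_sigma G\<^esub> = (mat 1, 0)"
  by (auto simp: E_points_sigma_def mem_Times_iff integer_mod_group_def)

lemma group_E_points_sigma:
  fixes G :: "('a::{field,finite} alg_closure^'n^'n) set"
  assumes G: "closed_subgroup (range to_ac) G"
  shows "group (E_points_sigma G)"
proof -
  have frob_E: "(frob ^^ 2) ((frob ^^ i) g) = (frob ^^ i) g" if "(frob ^^ 2) g = g"
    for g :: "'a alg_closure^'n^'n" and i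
    using that by (metis add.commute comp_apply funpow_add)
  show ?thesis
  proof (rule groupI)
    fix x y assume "x \<in> carrier (E_points_sigma G)" "y \<in> carrier (E_points_sigma G)"
    then show "x \<otimes>\<^bsub>E_points_sigma G\<^esub> y \<in> carrier (E_points_sigma G)"
      by (cases x; cases y) (auto simp: E_points_sigma_simps frob_funpow_mult frob_E
          intro!: closed_subgroup_mult[OF G] closed_subgroup_frob[OF G])
  next
    show "\<one>\<^bsub>E_points_sigma G\<^esub> \<in> carrier (E_points_sigma G)"
      by (simp add: E_points_sigma_simps closed_subgroup_one[OF G])
  next
    fix x y z
    assume "x \<in> carrier (E_points_sigma G)" "y \<in> carrier (E_points_sigma G)" "z \<in> carrier (E_points_sigma G)"
    then show "x \<otimes>\<^bsub>E_points_sigma G\<^esub> y \<otimes>\<^bsub>E_points_sigma G\<^esub> z =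
        x \<otimes>\<^bsub>E_points_sigma G\<^esub> (y \<otimes>\<^bsub>E_points_sigma G\<^esub> z)"
      by (cases x; cases y; cases z)
        (auto simp: E_points_sigma_simps matrix_mul_assoc frob_funpow_mult[of 1, simplified]
          numeral_2_eq_2)
  next
    fix x assume "x \<in> carrier (E_points_sigma G)"
    then show "\<one>\<^bsub>E_points_sigma G\<^esub> \<otimes>\<^bsub>E_points_sigma G\<^esub> x = x"
      by (cases x) (auto simp: E_points_sigma_simps)
  next
    fix x assume x: "x \<in> carrier (E_points_sigma G)"
    obtain g i where gi: "x = (g, i)" by (cases x)
    have g: "g \<in> G" "(frob ^^ 2) g = g" and i: "i = 0 \<or> i = 1"
      using x by (auto simp: gi E_points_sigma_simps)
    note inv = closed_subgroup_invertible[OF G g(1)]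
    let ?y = "((frob ^^ nat i) (matrix_inv g), i)"
    have "(frob ^^ nat i) (matrix_inv g) \<in> G"
      by (intro closed_subgroup_frob[OF G] closed_subgroup_inv[OF G] g(1))
    moreover have "(frob ^^ 2) ((frob ^^ nat i) (matrix_inv g)) = (frob ^^ nat i) (matrix_inv g)"
      by (rule frob_E) (simp add: frob_funpow_matrix_inv inv g(2))
    ultimately have "?y \<in> carrier (E_points_sigma G)"
      using i by (simp only: E_points_sigma_simps rational_points_simps fst_conv snd_conv) blast
    moreover have "?y \<otimes>\<^bsub>E_points_sigma G\<^esub> x = \<one>\<^bsub>E_points_sigma G\<^esub>"
      using i inv by (auto simp: gi E_points_sigma_simps matrix_inv_left simp flip: frob_funpow_mult)
    ultimately show "\<exists>y\<in>carrier (E_points_sigma G). y \<otimes>\<^bsub>E_points_sigma G\<^esub> x = \<one>\<^bsub>E_points_sigma G\<^esub>"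
      by blast
  qed
qed

section \<open>The norm map preserves averages\<close>

text \<open>
  Both sides are the sum of \<open>f (a\<inverse> F(a)) = \<phi> (F\<^sup>2(a) a\<inverse>)\<close> over the set \<open>Y\<close> of all \<open>a\<close> in \<open>H\<close> with \<open>a\<inverse> F(a)\<close>
  in \<open>H(\<bbbE>)\<close>. The group \<open>H(\<bbbF>)\<close> acts on \<open>Y\<close> by multiplication from the left, simply transitively on the fibres of
  \<open>a \<mapsto> a\<inverse> F(a)\<close>; the group \<open>H(\<bbbE>)\<close> acts from the right, simply transitively on the fibres of
  \<open>a \<mapsto> F\<^sup>2(a) a\<inverse>\<close>. Lang's theorem for \<open>F\<close> and for \<open>F\<^sup>2\<close> says that no fibre is empty.
\<close>
lemma norm_sum_eq:
  fixes H :: "('a::{field,finite} alg_closure^'n^'n) set" and f \<phi> :: "_ \<Rightarrow> complex"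
  assumes H: "closed_subgroup (range to_ac) H" and conn: "connectedin zariski H"
    and eq: "\<And>h a. h \<in> carrier (H(\<bbbE>)) \<Longrightarrow> a \<in> H \<Longrightarrow> h = lang_map 1 a \<Longrightarrow>
      f h = \<phi> ((frob ^^ 2) a ** matrix_inv a)"
  shows "of_nat (card (carrier (H(\<bbbF>)))) * (\<Sum>h\<in>carrier (H(\<bbbE>)). f h) =
    of_nat (card (carrier (H(\<bbbE>)))) * (\<Sum>y\<in>carrier (H(\<bbbF>)). \<phi> y)"
proof -
  note inv = closed_subgroup_invertible[OF H]
  note mult = closed_subgroup_mult[OF H] and minv = closed_subgroup_inv[OF H]
    and fr = closed_subgroup_frob[OF H]
  let ?E = "carrier (H(\<bbbE>))" and ?F = "carrier (H(\<bbbF>))"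
  define N where "N a = (frob ^^ 2) a ** matrix_inv a" for a :: "'a alg_closure^'n^'n"
  define Y where "Y = {a \<in> H. lang_map 1 a \<in> ?E}"
  have lang_mem: "lang_map e a \<in> H" if "a \<in> H" for a e
    using that by (simp add: lang_map_def mult minv fr)
  have N_mem: "N a \<in> H" if "a \<in> H" for a
    using that unfolding N_def by (intro mult minv fr)
  have Y_iff: "lang_map 1 a \<in> ?E \<longleftrightarrow> N a \<in> ?F" if a: "a \<in> H" for a
  proof -
    define b where "b = (frob ^^ 1) a"
    define c where "c = (frob ^^ 2) a"
    define d where "d = (frob ^^ 2) b"
    have d: "d = (frob ^^ 1) c"
      unfolding d_def b_def c_def by (simp add: numeral_2_eq_2)
    have i: "invertible a" "invertible b" "invertible c" "invertible d"
      unfolding d_def b_def c_def by (simp_all only: inv[OF a] invertible_frob_funpow)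
    have "lang_map 1 a \<in> ?E \<longleftrightarrow> matrix_inv c ** d = matrix_inv a ** b"
      using lang_mem[OF a, of 1]
      by (simp add: lang_map_def frob_funpow_mult frob_funpow_matrix_inv inv[OF a] flip: b_def c_def d_def del: One_nat_def)
    also have "\<dots> \<longleftrightarrow> d ** matrix_inv b = c ** matrix_inv a"
    proof
      assume eq: "matrix_inv c ** d = matrix_inv a ** b"
      have "d = c ** (matrix_inv c ** d)"
        by (simp only: matrix_inv_cancel(1)[OF i(3)])
      also have "\<dots> = (c ** matrix_inv a) ** b"
        by (simp only: eq matrix_mul_assoc)
      finally show "d ** matrix_inv b = c ** matrix_inv a"
        by (simp only: matrix_inv_cancel(3)[OF i(2)])
    next
      assume eq: "d ** matrix_inv b = c ** matrix_inv a"
      have "d = (d ** matrix_inv b) ** b"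
        by (simp only: matrix_inv_cancel(4)[OF i(2)])
      also have "\<dots> = c ** (matrix_inv a ** b)"
        by (simp only: eq matrix_mul_assoc)
      finally show "matrix_inv c ** d = matrix_inv a ** b"
        by (simp only: matrix_inv_cancel(2)[OF i(3)])
    qed
    also have "\<dots> \<longleftrightarrow> N a \<in> ?F"
      using N_mem[OF a]
      by (simp add: N_def frob_funpow_mult frob_funpow_matrix_inv inv[OF a] flip: b_def c_def d del: One_nat_def)
    finally show ?thesis .
  qed
  have card_E: "card {a \<in> Y. lang_map 1 a = h} = card ?F \<and> finite {a \<in> Y. lang_map 1 a = h}"
    if h: "h \<in> ?E" for h
  proof -
    obtain a where a: "a \<in> H" "lang_map 1 a = h"
      using lang[OF _ H conn, of 1 h] h by (auto simp: lang_map_def)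
    have bij: "bij_betw (\<lambda>c. c ** a) ?F {a \<in> Y. lang_map 1 a = h}"
    proof (rule bij_betwI[where g="\<lambda>b. b ** matrix_inv a"])
      show "(\<lambda>c. c ** a) \<in> ?F \<rightarrow> {a \<in> Y. lang_map 1 a = h}"
      proof
        fix c assume "c \<in> ?F"
        then have "lang_map 1 (c ** a) = h" "c ** a \<in> H"
          using a inv mult lang_map_fixed_mult[of c 1 a] by (auto simp: fixed_GL_def)
        then show "c ** a \<in> {a \<in> Y. lang_map 1 a = h}"
          using h by (simp add: Y_def)
      qed
      show "(\<lambda>b. b ** matrix_inv a) \<in> {a \<in> Y. lang_map 1 a = h} \<rightarrow> ?F"
      proof
        fix b assume "b \<in> {a \<in> Y. lang_map 1 a = h}"
        then show "b ** matrix_inv a \<in> ?F"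
          using a inv mult minv lang_map_fibre[of a b 1] by (auto simp: fixed_GL_def Y_def)
      qed
    qed (simp_all add: matrix_inv_cancel inv[OF a(1)])
    show ?thesis
      using bij_betw_same_card[OF bij] bij_betw_finite[OF bij] finite_rational_points[of 1 H] by simp
  qed
  have card_F: "card {a \<in> Y. N a = y} = card ?E" if y: "y \<in> ?F" for y
  proof -
    have "matrix_inv y \<in> H" and yi: "invertible y"
      using y minv inv by auto
    \<comment> \<open>Inverting \<open>t\<inverse> F\<^sup>2(t) = y\<inverse>\<close> gives \<open>F\<^sup>2(a) a\<inverse> = y\<close> for \<open>a = t\<inverse>\<close>.\<close>
    then obtain t where t: "t \<in> H" "matrix_inv t ** (frob ^^ 2) t = matrix_inv y"
      using lang[OF _ H conn, of 2 "matrix_inv y"] by auto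
    define a where "a = matrix_inv t"
    have a: "a \<in> H"
      using t(1) minv by (simp add: a_def)
    have Na: "(frob ^^ 2) a = y ** a"
    proof -
      have "(frob ^^ 2) t = t ** matrix_inv y"
        using t by (metis matrix_inv_cancel(1) inv)
      then have "(frob ^^ 2) a = matrix_inv (t ** matrix_inv y)"
        using inv[OF t(1)] by (simp add: a_def frob_funpow_matrix_inv)
      also have "\<dots> = matrix_inv (matrix_inv y) ** a"
        using inv[OF t(1)] yi by (simp add: a_def matrix_inv_mult invertible_matrix_inv)
      also have "matrix_inv (matrix_inv y) = y"
        using yi by (intro matrix_inv_unique_left invertible_matrix_inv) (simp_all add: matrix_inv_right)
      finally show ?thesis .
    qed
    have N_iff: "N b = y \<longleftrightarrow> (frob ^^ 2) b = y ** b" if "b \<in> H" for b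
      using inv[OF that] unfolding N_def by (metis matrix_inv_cancel(3,4))
    have bij: "bij_betw (\<lambda>c. a ** c) ?E {a \<in> Y. N a = y}"
    proof (rule bij_betwI[where g="\<lambda>b. matrix_inv a ** b"])
      show "(\<lambda>c. a ** c) \<in> ?E \<rightarrow> {a \<in> Y. N a = y}"
      proof
        fix c assume "c \<in> ?E"
        then have ac: "a ** c \<in> H" "(frob ^^ 2) (a ** c) = y ** (a ** c)"
          using a mult by (simp_all add: frob_funpow_mult Na matrix_mul_assoc)
        then have "N (a ** c) = y"
          using N_iff by blast
        then show "a ** c \<in> {a \<in> Y. N a = y}"
          using Y_iff[OF ac(1)] y ac(1) unfolding Y_def by blast
      qed
      show "(\<lambda>b. matrix_inv a ** b) \<in> {a \<in> Y. N a = y} \<rightarrow> ?E"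
      proof
        fix b assume "b \<in> {a \<in> Y. N a = y}"
        then have b: "b \<in> H" "(frob ^^ 2) b = y ** b"
          using N_iff by (auto simp: Y_def)
        have "(frob ^^ 2) (matrix_inv a ** b) = matrix_inv (y ** a) ** (y ** b)"
          using inv[OF a] by (simp add: frob_funpow_mult frob_funpow_matrix_inv Na b(2))
        also have "\<dots> = matrix_inv a ** b"
          using inv[OF a] yi by (simp add: matrix_inv_mult matrix_inv_cancel flip: matrix_mul_assoc)
        finally show "matrix_inv a ** b \<in> ?E"
          using a b(1) by (simp add: mult minv)
      qed
    qed (simp_all add: matrix_inv_cancel inv[OF a])
    show ?thesis
      using bij_betw_same_card[OF bij] by simp
  qed
  have fin: "finite ?E" "finite ?F"
    by (simp_all add: finite_rational_points)
  have "Y = (\<Union>h\<in>?E. {a \<in> Y. lang_map 1 a = h})"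
    by (auto simp: Y_def)
  then have finY: "finite Y"
    using card_E fin(1) by (metis (no_types, lifting) finite_UN_I)
  have N_Y: "N ` Y \<subseteq> ?F"
    using Y_iff unfolding Y_def by blast
  have "of_nat (card ?F) * (\<Sum>h\<in>?E. f h) = (\<Sum>h\<in>?E. \<Sum>a\<in>{a \<in> Y. lang_map 1 a = h}. f (lang_map 1 a))"
    by (simp add: card_E sum_distrib_left del: rational_points_simps One_nat_def)
  also have "\<dots> = (\<Sum>a\<in>Y. f (lang_map 1 a))"
    by (rule sum.group[OF finY fin(1)]) (auto simp: Y_def)
  also have "\<dots> = (\<Sum>a\<in>Y. \<phi> (N a))"
    unfolding N_def by (intro sum.cong refl eq) (auto simp: Y_def)
  also have "\<dots> = (\<Sum>y\<in>?F. \<Sum>a\<in>{a \<in> Y. N a = y}. \<phi> (N a))"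
    by (rule sum.group[OF finY fin(2) N_Y, symmetric])
  also have "\<dots> = of_nat (card ?E) * (\<Sum>y\<in>?F. \<phi> y)"
    by (simp add: card_F sum_distrib_left del: rational_points_simps One_nat_def)
  finally show ?thesis .
qed

text \<open>
  With \<open>g = a\<inverse> F(a)\<close>, the product \<open>a g F(g) a\<inverse>\<close> telescopes to \<open>F\<^sup>2(a) a\<inverse>\<close>.
\<close>
lemma norm_mem_Nm:
  fixes G :: "('a::{field,finite} alg_closure^'n^'n) set"
  assumes G: "closed_subgroup (range to_ac) G" and a: "a \<in> G"
  shows "(frob ^^ 2) a ** matrix_inv a \<in> Nm G (lang_map 1 a)"
proof -
  let ?g = "lang_map 1 a"
  have i: "invertible a"
    by (rule closed_subgroup_invertible[OF G a])
  have one: "mat 1 \<in> carrier (G(\<bbbF>))" "matrix_inv (mat 1) = (mat 1 :: 'a alg_closure^'n^'n)"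
    using closed_subgroup_one[OF G] frob_funpow_mat_1[of 1]
    by (auto intro!: matrix_inv_unique_left simp: invertible_def intro: exI[of _ "mat 1"])
  have "a ** ?g ** frob ?g ** matrix_inv a = (frob ^^ 2) a ** matrix_inv a"
    using i frob_funpow_mult[of 1 "matrix_inv a" "frob a"] frob_funpow_matrix_inv[OF i, of 1]
      invertible_frob_funpow[OF i, of 1]
    by (simp add: lang_map_def matrix_mul_assoc matrix_inv_cancel matrix_inv_right numeral_2_eq_2)
  then have "(frob ^^ 2) a ** matrix_inv a =
      mat 1 ** (a ** ?g ** frob ?g ** matrix_inv a) ** matrix_inv (mat 1)"
    by (simp add: one(2))
  moreover have "?g = matrix_inv a ** frob a"
    by (simp add: lang_map_def)
  ultimately show ?thesis
    unfolding Nm_def mem_Collect_eq using one(1) a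
    by (intro exI[of _ "mat 1"] exI[of _ a] conjI)
qed

section \<open>Multiplicities under basechange\<close>
theorem proposition2p1:
  fixes G H :: "('a::{field,finite} alg_closure^'n^'n) set"
    and \<pi>\<^sub>1 :: "'a alg_closure^'n^'n \<Rightarrow> complex^'d1^'d1"
    and \<pi>\<^sub>2 :: "'a alg_closure^'n^'n \<Rightarrow> complex^'d2^'d2"
    and \<pi>E\<^sub>1 :: "'a alg_closure^'n^'n \<Rightarrow> complex^'e1^'e1"
    and \<pi>E\<^sub>2 :: "'a alg_closure^'n^'n \<Rightarrow> complex^'e2^'e2"
    and \<pi>E'\<^sub>1 :: "('a alg_closure^'n^'n) \<times> int \<Rightarrow> complex^'e1^'e1"
    and \<pi>E'\<^sub>2 :: "('a alg_closure^'n^'n) \<times> int \<Rightarrow> complex^'e2^'e2"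
  assumes "connected_reductive G" and "connected_reductive H" and "H \<subseteq> G"
    and "uniform_rep G \<pi>\<^sub>1" and "uniform_rep H \<pi>\<^sub>2"
    and "is_basechange G \<pi>\<^sub>1 \<pi>E\<^sub>1" and "is_basechange H \<pi>\<^sub>2 \<pi>E\<^sub>2"
    and "shintani_extension G \<pi>\<^sub>1 \<pi>E\<^sub>1 \<pi>E'\<^sub>1" and "shintani_extension H \<pi>\<^sub>2 \<pi>E\<^sub>2 \<pi>E'\<^sub>2"
  shows "2 * hom_dim (E_points_sigma H) \<pi>E'\<^sub>1 \<pi>E'\<^sub>2 =
         hom_dim (H(\<bbbE>)) \<pi>E\<^sub>1 \<pi>E\<^sub>2 + hom_dim (H(\<bbbF>)) \<pi>\<^sub>1 \<pi>\<^sub>2"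
proof -
  have G: "closed_subgroup (range to_ac) G" and H: "closed_subgroup (range to_ac) H"
    and conn: "connectedin zariski H"
    using assms(1,2) by (simp_all add: connected_reductive_def)
  let ?E = "carrier (H(\<bbbE>))" and ?F = "carrier (H(\<bbbF>))" and ?K = "E_points_sigma H"
  have subset: "carrier (rational_points m H) \<subseteq> carrier (rational_points m G)" for m
    using assms(3) by auto
  have rep1: "representation (H(\<bbbF>)) \<pi>\<^sub>1" "representation (H(\<bbbE>)) \<pi>E\<^sub>1" "representation ?K \<pi>E'\<^sub>1"
  proof -
    have "representation (G(\<bbbF>)) \<pi>\<^sub>1" "representation (G(\<bbbE>)) \<pi>E\<^sub>1"
      using assms(6) by (simp_all add: is_basechange_def irreducible_rep_def)
    then show "representation (H(\<bbbF>)) \<pi>\<^sub>1" "representation (H(\<bbbE>)) \<pi>E\<^sub>1"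
      using subset by (auto elim!: representation_subset simp del: rational_points_simps(1))
    have "representation (E_points_sigma G) \<pi>E'\<^sub>1"
      using assms(8) by (simp add: shintani_extension_def)
    then show "representation ?K \<pi>E'\<^sub>1"
      by (rule representation_subset) (use subset[of 2] in \<open>auto simp: E_points_sigma_def\<close>)
  qed
  have rep2: "representation (H(\<bbbF>)) \<pi>\<^sub>2" "representation (H(\<bbbE>)) \<pi>E\<^sub>2" "representation ?K \<pi>E'\<^sub>2"
    using assms(7,9) by (simp_all add: is_basechange_def irreducible_rep_def shintani_extension_def)
  have fin: "finite ?E" "finite ?F"
    by (simp_all add: finite_rational_points del: rational_points_simps One_nat_def)
  have carrier_K: "carrier ?K = ?E \<times> {0, 1}"
    by (auto simp: E_points_sigma_simps mem_Times_iff)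
  \<comment> \<open>The norms for \<open>H\<close> and \<open>G\<close> are compatible: the same \<open>a\<close> in \<open>H\<close> computes both.\<close>
  define f where "f h = trace (\<pi>E'\<^sub>2 (h, 1)) * cnj (trace (\<pi>E'\<^sub>1 (h, 1)))" for h
  define \<phi> where "\<phi> y = trace (\<pi>\<^sub>2 y) * cnj (trace (\<pi>\<^sub>1 y))" for y
  have f_\<phi>: "f h = \<phi> ((frob ^^ 2) a ** matrix_inv a)"
    if h: "h \<in> ?E" and a: "a \<in> H" and ha: "h = lang_map 1 a" for h a
  proof -
    have "(frob ^^ 2) a ** matrix_inv a \<in> Nm H h" "(frob ^^ 2) a ** matrix_inv a \<in> Nm G h"
      using norm_mem_Nm[OF H a] norm_mem_Nm[OF G, of a] a assms(3) ha by auto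
    then show ?thesis
      using assms(8,9) h subset[of 2] unfolding f_def \<phi>_def shintani_extension_def
      by (metis (no_types, lifting) subsetD)
  qed
  have sigma_part: "of_nat (card ?F) * (\<Sum>h\<in>?E. f h) = of_nat (card ?E) * (\<Sum>y\<in>?F. \<phi> y)"
    by (rule norm_sum_eq[OF H conn]) (rule f_\<phi>)
  have F_part: "(\<Sum>y\<in>?F. \<phi> y) = of_nat (card ?F) * of_nat (hom_dim (H(\<bbbF>)) \<pi>\<^sub>1 \<pi>\<^sub>2)"
    unfolding \<phi>_def
    by (rule hom_dim_eq_character_product[OF group_rational_points[OF H] fin(2) rep1(1) rep2(1), symmetric])
  have E_part: "(\<Sum>h\<in>?E. trace (\<pi>E'\<^sub>2 (h, 0)) * cnj (trace (\<pi>E'\<^sub>1 (h, 0)))) =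
      of_nat (card ?E) * of_nat (hom_dim (H(\<bbbE>)) \<pi>E\<^sub>1 \<pi>E\<^sub>2)"
    unfolding hom_dim_eq_character_product[OF group_rational_points[OF H] fin(1) rep1(2) rep2(2)]
    using assms(8,9) subset[of 2] by (intro sum.cong refl) (auto simp: shintani_extension_def subset_iff)
  have "of_nat (card (carrier ?K)) * of_nat (hom_dim ?K \<pi>E'\<^sub>1 \<pi>E'\<^sub>2) =
      (\<Sum>x\<in>carrier ?K. trace (\<pi>E'\<^sub>2 x) * cnj (trace (\<pi>E'\<^sub>1 x)))"
    by (rule hom_dim_eq_character_product[OF group_E_points_sigma[OF H] _ rep1(3) rep2(3)])
      (simp add: carrier_K fin(1))
  also have "\<dots> = (\<Sum>h\<in>?E. \<Sum>i\<in>{0, 1}. trace (\<pi>E'\<^sub>2 (h, i)) * cnj (trace (\<pi>E'\<^sub>1 (h, i))))"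
    unfolding carrier_K sum.cartesian_product by (simp only: case_prod_unfold prod.collapse)
  also have "\<dots> = of_nat (card ?E) * of_nat (hom_dim (H(\<bbbE>)) \<pi>E\<^sub>1 \<pi>E\<^sub>2) + (\<Sum>h\<in>?E. f h)"
    by (simp add: sum.distrib E_part f_def del: rational_points_simps)
  finally have total: "(of_nat (card ?E) :: complex) * (2 * of_nat (hom_dim ?K \<pi>E'\<^sub>1 \<pi>E'\<^sub>2)) =
      of_nat (card ?E) * of_nat (hom_dim (H(\<bbbE>)) \<pi>E\<^sub>1 \<pi>E\<^sub>2) + (\<Sum>h\<in>?E. f h)"
    by (simp add: carrier_K card_cartesian_product mult_ac del: rational_points_simps)
  have pos: "card ?E \<noteq> 0" "card ?F \<noteq> 0"
  proof -
    have "mat 1 \<in> carrier (rational_points m H)" for m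
      by (simp add: closed_subgroup_one[OF H])
    then show "card ?E \<noteq> 0" "card ?F \<noteq> 0"
      using fin card_0_eq by blast+
  qed
  have "(\<Sum>h\<in>?E. f h) = of_nat (card ?E) * of_nat (hom_dim (H(\<bbbF>)) \<pi>\<^sub>1 \<pi>\<^sub>2)"
    using sigma_part[unfolded F_part] pos(2) by (simp del: One_nat_def)
  then have "of_nat (card ?E) * (2 * of_nat (hom_dim ?K \<pi>E'\<^sub>1 \<pi>E'\<^sub>2)) =
      (of_nat (card ?E) :: complex) * (of_nat (hom_dim (H(\<bbbE>)) \<pi>E\<^sub>1 \<pi>E\<^sub>2) + of_nat (hom_dim (H(\<bbbF>)) \<pi>\<^sub>1 \<pi>\<^sub>2))"
    using total by (simp add: distrib_left)
  then have "(of_nat (2 * hom_dim ?K \<pi>E'\<^sub>1 \<pi>E'\<^sub>2) :: complex) =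
      of_nat (hom_dim (H(\<bbbE>)) \<pi>E\<^sub>1 \<pi>E\<^sub>2 + hom_dim (H(\<bbbF>)) \<pi>\<^sub>1 \<pi>\<^sub>2)"
    using pos(1) by simp
  then show ?thesis
    by (simp only: of_nat_eq_iff)
qed

end
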